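(* Let $n\ge1$ and let $\pi=\{B_1,\dots,B_k\}$ be a set partition of $[n]=\{1,\dots,n\}$ ("books" $1,\dots,n$ divided into classes $B_1,\dots,B_k$). A library configuration is an ordering of the blocks $B_1,\dots,B_k$ onto shelves $1,\dots,k$ (one block per shelf) together with a linear order of the books on each shelf. Let $(w_E)_{E\subseteq[n]}$ be a probability distribution on subsets of $[n]$. The library walk moves from a configuration as follows: choose $E$ with probability $w_E$; let $K_E$ be the union of the blocks $B_i$ meeting $E$; reorder the shelves so that those holding blocks contained in $K_E$ come first, in their previous relative order, followed by the others in their previous relative order; then on each shelf put the books of $E$ first, in their previous relative order, followed by the remaining books of that shelf in their previous relative order. Let $P_w$ be the transition matrix of this Markov chain on configurations. Then: (1) $P_w$ is diagonalizable. (2) For each pair of set partitions $(\alpha,\beta)$ of $[n]$ such that $\beta$ refines $\pi$ and $\pi$ refines $\alpha$, there is an eigenvalue $\varepsilon_{(\alpha,\beta)}=\sum w_E$, the sum extending over all $E\subseteq[n]$ such that $E$ is a union of blocks of $\beta$ and $K_E$ (the union of the shelves containing some element of $E$) is a union of blocks of $\alpha$. (3) The multiplicity of $\varepsilon_{(\alpha,\beta)}$ is $\prod_i (p_i-1)!\,\prod_j (q_j-1)!$, where $p_1,p_2,\dots$ are the block sizes of $\beta$ and $q_1,q_2,\dots$ are the block sizes of $\alpha$ modulo $\pi$ (i.e., $q_j$ is the number of blocks of $\pi$ contained in the $j$-th block of $\alpha$). (4) These are all the eigenvalues of $P_w$. (5) If the semigroup $\mathrm{Fib}$ described below is generated by $\{[q_E,t_E]:w_E>0\}$,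 then the library walk has a unique stationary distribution.
   Context: Semigroup model: an ordered set partition of $[n]$ is a sequence $\langle X_1\mid\cdots\mid X_p\rangle$ of disjoint nonempty blocks with union $[n]$; composition is $X\circ Y=\langle X_a\cap Y_b\rangle$ with the nonempty intersections ordered lexicographically by $(a,b)$. Write $Y\le X$ if $Y\circ X=X$ ($X$ refines $Y$ compatibly with the order). $\mathrm{Fib}$ is the set of pairs $[q,t]$ of ordered set partitions with $q\le t$ such that each block of $q$ is a union of blocks of $\pi$, with composition $[Y,X]\circ[R,S]=[Y\circ R,\ Y\circ R\circ X\circ S]$. A configuration is identified with $[p,s]\in\mathrm{Fib}$ where $p$ lists the blocks $B_i$ in shelf order and $s$ is the ordered partition into singletons listing the books shelf by shelf. For $E\subseteq[n]$ let $q_E=\langle K_E\mid[n]\setminus K_E\rangle$ and $t_E=\langle E\mid K_E\setminus E\mid[n]\setminus K_E\rangle$ (empty blocks omitted); the library step with chosen set $E$ sends $c$ to $[q_E,t_E]\circ c$, so $P_w(c,d)=\sum_{E:\,[q_E,t_E]\circ c=d}w_E$. *)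

theory Defs
  imports
    "Jordan_Normal_Form.Char_Poly"
    "HOL-Library.Disjoint_Sets"
begin

definition union_of_blocks :: "'a set set \<Rightarrow> 'a set \<Rightarrow> bool" where
  "union_of_blocks P A \<longleftrightarrow> (\<exists>Q \<subseteq> P. A = \<Union>Q)"

definition K_set :: "nat set set \<Rightarrow> nat set \<Rightarrow> nat set" where
  "K_set \<pi> E = \<Union>{B \<in> \<pi>. B \<inter> E \<noteq> {}}"


section \<open>The library walk\<close>

text \<open>A configuration is the list of shelves in shelf order, each shelf being the list of its
  books in order.\<close>

definition library_configs :: "nat set set \<Rightarrow> nat list list set" where
  "library_configs \<pi> =
     {c. distinct (map set c) \<and> set (map set c) = \<pi> \<and> (\<forall>sh \<in> set c. distinct sh)}"

definition shelf_step :: "nat set \<Rightarrow> nat list \<Rightarrow> nat list" where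
  "shelf_step E sh = filter (\<lambda>x. x \<in> E) sh @ filter (\<lambda>x. x \<notin> E) sh"

definition library_step :: "nat set set \<Rightarrow> nat set \<Rightarrow> nat list list \<Rightarrow> nat list list" where
  "library_step \<pi> E c =
     map (shelf_step E)
       (filter (\<lambda>sh. set sh \<subseteq> K_set \<pi> E) c @ filter (\<lambda>sh. \<not> set sh \<subseteq> K_set \<pi> E) c)"

definition subset_distribution :: "nat \<Rightarrow> (nat set \<Rightarrow> real) \<Rightarrow> bool" where
  "subset_distribution n w \<longleftrightarrow>
     (\<forall>E \<in> Pow {1..n}. w E \<ge> 0) \<and> (\<Sum>E \<in> Pow {1..n}. w E) = 1"

definition library_prob ::
  "nat \<Rightarrow> nat set set \<Rightarrow> (nat set \<Rightarrow> real) \<Rightarrow> nat list list \<Rightarrow> nat list list \<Rightarrow> real" where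
  "library_prob n \<pi> w c d = (\<Sum>E | E \<subseteq> {1..n} \<and> library_step \<pi> E c = d. w E)"

text \<open>The transition matrix with respect to an enumeration \<open>cs\<close> of the configurations; the
  entry in row \<open>i\<close> and column \<open>j\<close> is the probability of moving from \<open>cs ! i\<close> to \<open>cs ! j\<close>.\<close>

definition library_matrix ::
  "nat \<Rightarrow> nat set set \<Rightarrow> (nat set \<Rightarrow> real) \<Rightarrow> nat list list list \<Rightarrow> real mat" where
  "library_matrix n \<pi> w cs =
     mat (length cs) (length cs) (\<lambda>(i, j). library_prob n \<pi> w (cs ! i) (cs ! j))"

definition diagonalizable_mat :: "'a :: semiring_1 mat \<Rightarrow> bool" where
  "diagonalizable_mat A \<longleftrightarrow> (\<exists>D. diagonal_mat D \<and> similar_mat A D)"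

definition stationary_distribution :: "real mat \<Rightarrow> real vec \<Rightarrow> bool" where
  "stationary_distribution P \<mu> \<longleftrightarrow>
     \<mu> \<in> carrier_vec (dim_row P) \<and>
     (\<forall>i < dim_row P. \<mu> $ i \<ge> 0) \<and> (\<Sum>i < dim_row P. \<mu> $ i) = 1 \<and>
     transpose_mat P *\<^sub>v \<mu> = \<mu>"


section \<open>Eigenvalues and multiplicities\<close>

definition library_pairs :: "nat \<Rightarrow> nat set set \<Rightarrow> (nat set set \<times> nat set set) set" where
  "library_pairs n \<pi> = {(\<alpha>, \<beta>). refines {1..n} \<beta> \<pi> \<and> refines {1..n} \<pi> \<alpha>}"

definition library_eigenvalue ::
  "nat \<Rightarrow> nat set set \<Rightarrow> (nat set \<Rightarrow> real) \<Rightarrow> nat set set \<Rightarrow> nat set set \<Rightarrow> real" where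
  "library_eigenvalue n \<pi> w \<alpha> \<beta> =
     (\<Sum>E | E \<subseteq> {1..n} \<and> union_of_blocks \<beta> E \<and> union_of_blocks \<alpha> (K_set \<pi> E). w E)"

text \<open>Distinct pairs can give the same number; the multiplicity of that number as a root of the
  characteristic polynomial is then the sum of the multiplicities of these pairs.\<close>

definition library_multiplicity :: "nat set set \<Rightarrow> nat set set \<Rightarrow> nat set set \<Rightarrow> nat" where
  "library_multiplicity \<pi> \<alpha> \<beta> =
     (\<Prod>b \<in> \<beta>. fact (card b - 1)) * (\<Prod>a \<in> \<alpha>. fact (card {B \<in> \<pi>. B \<subseteq> a} - 1))"


section \<open>The semigroup Fib\<close>

definition ordered_partition_on :: "'a set \<Rightarrow> 'a set list \<Rightarrow> bool" where
  "ordered_partition_on A X \<longleftrightarrow> distinct X \<and> partition_on A (set X)"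

definition drop_empty :: "'a set list \<Rightarrow> 'a set list" where
  "drop_empty X = filter (\<lambda>B. B \<noteq> {}) X"

definition op_comp :: "'a set list \<Rightarrow> 'a set list \<Rightarrow> 'a set list" where
  "op_comp X Y = drop_empty (concat (map (\<lambda>A. map (\<lambda>B. A \<inter> B) Y) X))"

definition op_le :: "'a set list \<Rightarrow> 'a set list \<Rightarrow> bool" where
  "op_le Y X \<longleftrightarrow> op_comp Y X = X"

definition Fib :: "nat \<Rightarrow> nat set set \<Rightarrow> (nat set list \<times> nat set list) set" where
  "Fib n \<pi> = {(q, t). ordered_partition_on {1..n} q \<and> ordered_partition_on {1..n} t \<and>
                       op_le q t \<and> (\<forall>b \<in> set q. union_of_blocks \<pi> b)}"

fun fib_comp :: "nat set list \<times> nat set list \<Rightarrow> nat set list \<times> nat set list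
    \<Rightarrow> nat set list \<times> nat set list" where
  "fib_comp (Y, X) (R, S) = (op_comp Y R, op_comp (op_comp (op_comp Y R) X) S)"

definition q_part :: "nat \<Rightarrow> nat set set \<Rightarrow> nat set \<Rightarrow> nat set list" where
  "q_part n \<pi> E = drop_empty [K_set \<pi> E, {1..n} - K_set \<pi> E]"

definition t_part :: "nat \<Rightarrow> nat set set \<Rightarrow> nat set \<Rightarrow> nat set list" where
  "t_part n \<pi> E = drop_empty [E, K_set \<pi> E - E, {1..n} - K_set \<pi> E]"

inductive_set semigroup_span :: "('a \<Rightarrow> 'a \<Rightarrow> 'a) \<Rightarrow> 'a set \<Rightarrow> 'a set"
  for f :: "'a \<Rightarrow> 'a \<Rightarrow> 'a" and S :: "'a set" where
  base: "x \<in> S \<Longrightarrow> x \<in> semigroup_span f S"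
| comp: "x \<in> semigroup_span f S \<Longrightarrow> y \<in> semigroup_span f S \<Longrightarrow> f x y \<in> semigroup_span f S"


section \<open>The walk as an action of Fib\<close>

text \<open>The step of the walk, defined by rearranging lists, is left multiplication in Fib under the
  identification of configurations with elements of Fib.\<close>

definition fib_of_config :: "nat list list \<Rightarrow> nat set list \<times> nat set list" where
  "fib_of_config c = (map set c, map (\<lambda>x. {x}) (concat c))"

lemma drop_empty_simps [simp]:
  "drop_empty [] = []"
  "drop_empty (A # X) = (if A = {} then drop_empty X else A # drop_empty X)"
  "drop_empty (X @ Y) = drop_empty X @ drop_empty Y"
  by (simp_all add: drop_empty_def)

lemma drop_empty_map_Int_drop_empty:
  "drop_empty (map ((\<inter>) A) (drop_empty X)) = drop_empty (map ((\<inter>) A) X)"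
  by (induction X) auto

lemma op_comp_Nil [simp]: "op_comp [] Y = []"
  by (simp add: op_comp_def)

lemma op_comp_Cons [simp]: "op_comp (A # X) Y = drop_empty (map ((\<inter>) A) Y) @ op_comp X Y"
  by (simp add: op_comp_def)

lemma op_comp_append: "op_comp (X @ X') Y = op_comp X Y @ op_comp X' Y"
  by (simp add: op_comp_def)

lemma op_comp_drop_empty_left [simp]: "op_comp (drop_empty X) Y = op_comp X Y"
proof -
  have "drop_empty (map ((\<inter>) {}) Y) = []" for Y :: "'a set list"
    by (induction Y) auto
  then show ?thesis by (induction X) auto
qed

lemma op_comp_map_Int_left:
  "op_comp (map ((\<inter>) A) X) Y = drop_empty (map ((\<inter>) A) (op_comp X Y))"
proof (induction X)
  case (Cons B X)
  have "drop_empty (map ((\<inter>) (A \<inter> B)) Y) = drop_empty (map ((\<inter>) A) (map ((\<inter>) B) Y))"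
    by (induction Y) (auto simp: Int_assoc)
  then show ?case
    using Cons by (simp add: drop_empty_map_Int_drop_empty del: map_map)
qed simp

lemma op_comp_assoc: "op_comp (op_comp X Y) Z = op_comp X (op_comp Y Z)"
  by (induction X) (simp_all add: op_comp_append op_comp_map_Int_left)

lemma drop_empty_Int_singletons:
  "drop_empty (map ((\<inter>) A) (map (\<lambda>x. {x}) xs)) = map (\<lambda>x. {x}) (filter (\<lambda>x. x \<in> A) xs)"
  by (induction xs) auto

lemma filter_concat_shelf:
  assumes "distinct (map set c)" "disjoint (set ` set c)" "sh \<in> set c"
  shows "filter (\<lambda>x. x \<in> set sh) (concat c) = sh"
  using assms
proof (induction c)
  case (Cons a c)
  have *: "filter (\<lambda>x. x \<in> set sh) (concat c) = []" if "\<forall>s \<in> set c. set s \<inter> set sh = {}"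
    using that by (auto simp: filter_empty_conv)
  show ?case
  proof (cases "sh = a")
    case True
    have "set s \<inter> set sh = {}" if "s \<in> set c" for s
    proof (rule disjointD[OF Cons.prems(2)])
      show "set s \<noteq> set sh" using Cons.prems(1) True that by auto
    qed (use True that in auto)
    then have "filter (\<lambda>x. x \<in> set sh) (concat c) = []" by (intro *) blast
    then show ?thesis using True by simp
  next
    case False
    then have sh: "sh \<in> set c" using Cons.prems by auto
    have "set a \<inter> set sh = {}"
    proof (rule disjointD[OF Cons.prems(2)])
      show "set a \<noteq> set sh" using Cons.prems(1) sh by auto
    qed (use sh in auto)
    then have "filter (\<lambda>x. x \<in> set sh) a = []" by (auto simp: filter_empty_conv)
    moreover have "disjoint (set ` set c)"
      using Cons.prems(2) by (auto simp: disjoint_def)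
    ultimately show ?thesis using Cons sh by simp
  qed
qed simp

theorem fib_of_config_library_step:
  assumes \<pi>: "partition_on {1..n} \<pi>" and E: "E \<subseteq> {1..n}" and c: "c \<in> library_configs \<pi>"
  shows "fib_of_config (library_step \<pi> E c) =
           fib_comp (q_part n \<pi> E, t_part n \<pi> E) (fib_of_config c)"
proof -
  define K where "K = K_set \<pi> E"
  define c' where "c' = filter (\<lambda>sh. set sh \<subseteq> K) c @ filter (\<lambda>sh. \<not> set sh \<subseteq> K) c"
  have blocks: "distinct (map set c)" "set ` set c = \<pi>"
    using c by (auto simp: library_configs_def)
  have disj: "disjoint \<pi>" and ne: "{} \<notin> \<pi>" and Un: "\<Union>\<pi> = {1..n}"
    using \<pi> by (auto simp: partition_on_def)
  have inK: "set sh \<subseteq> K \<or> set sh \<inter> K = {}" if "sh \<in> set c" for sh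
    using that blocks(2) disj unfolding K_def K_set_def disjoint_def by blast
  have E_K: "E \<subseteq> K"
    using E Un unfolding K_def K_set_def by blast
  have nonempty: "set sh \<noteq> {}" if "sh \<in> set c" for sh
    using that blocks(2) ne by (metis imageI)
  have sub: "set sh \<subseteq> {1..n}" if "sh \<in> set c" for sh
    using that blocks(2) Un by blast
  have 1: "drop_empty (map ((\<inter>) K) (map set d)) = map set (filter (\<lambda>sh. set sh \<subseteq> K) d)"
    if "set d \<subseteq> set c" for d
    using that by (induction d) (use inK nonempty in \<open>auto simp: Int_absorb1 Int_commute\<close>)
  have 2: "drop_empty (map ((\<inter>) ({1..n} - K)) (map set d)) =
             map set (filter (\<lambda>sh. \<not> set sh \<subseteq> K) d)" if "set d \<subseteq> set c" for d
    using that
  proof (induction d)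
    case (Cons sh d)
    have "({1..n} - K) \<inter> set sh = (if set sh \<subseteq> K then {} else set sh)"
      using inK[of sh] sub[of sh] Cons.prems by auto
    then show ?case using Cons nonempty[of sh] by simp
  qed simp
  have q: "op_comp (q_part n \<pi> E) (map set c) = map set c'"
    using 1[of c] 2[of c] by (simp add: q_part_def K_def[symmetric] c'_def
        del: drop_empty_simps(2) map_map)
  define L where "L = filter (\<lambda>x. x \<in> E) (concat c) @ filter (\<lambda>x. x \<in> K - E) (concat c) @
                        filter (\<lambda>x. x \<in> {1..n} - K) (concat c)"
  have t: "op_comp (t_part n \<pi> E) (map (\<lambda>x. {x}) (concat c)) = map (\<lambda>x. {x}) L"
    by (simp add: t_part_def K_def[symmetric] L_def drop_empty_Int_singletons
        del: drop_empty_simps(2) map_map)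
  have L: "filter (\<lambda>x. x \<in> set sh) L = shelf_step E sh" if sh: "sh \<in> set c" for sh
  proof -
    have swap: "filter (\<lambda>x. x \<in> set sh) (filter Q (concat c)) = filter Q sh" for Q
    proof -
      have "filter (\<lambda>x. x \<in> set sh) (filter Q (concat c)) =
              filter Q (filter (\<lambda>x. x \<in> set sh) (concat c))"
        by (simp only: filter_filter conj_commute)
      then show ?thesis using filter_concat_shelf[OF blocks(1) _ sh] blocks(2) disj by simp
    qed
    have "filter (\<lambda>x. x \<in> K - E) sh @ filter (\<lambda>x. x \<in> {1..n} - K) sh = filter (\<lambda>x. x \<notin> E) sh"
    proof (cases "set sh \<subseteq> K")
      case True
      then have "filter (\<lambda>x. x \<in> {1..n} - K) sh = []" by (auto simp: filter_empty_conv)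
      moreover have "filter (\<lambda>x. x \<in> K - E) sh = filter (\<lambda>x. x \<notin> E) sh"
        using True by (intro filter_cong) auto
      ultimately show ?thesis by simp
    next
      case False
      then have d: "set sh \<inter> K = {}" using inK sh by blast
      then have "filter (\<lambda>x. x \<in> K - E) sh = []" by (auto simp: filter_empty_conv)
      moreover have "filter (\<lambda>x. x \<in> {1..n} - K) sh = filter (\<lambda>x. x \<notin> E) sh"
        using d E_K sub[OF sh] by (intro filter_cong) auto
      ultimately show ?thesis by simp
    qed
    then show ?thesis unfolding L_def shelf_step_def filter_append swap by simp
  qed
  have 3: "op_comp (map set d) (map (\<lambda>x. {x}) L) = map (\<lambda>x. {x}) (concat (map (shelf_step E) d))"
    if "set d \<subseteq> set c" for d
    using that by (induction d) (simp_all add: drop_empty_Int_singletons L del: map_map)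
  have c'c: "set c' \<subseteq> set c" by (auto simp: c'_def)
  have "set (shelf_step E sh) = set sh" for sh
    by (auto simp: shelf_step_def)
  then show ?thesis
    using 3[OF c'c]
    by (simp add: fib_of_config_def q op_comp_assoc t library_step_def K_def[symmetric]
        c'_def[symmetric] comp_def)
qed

end

theory Submission
  imports "Jordan_Normal_Form.DL_Rank" "HOL-Combinatorics.Multiset_Permutations" Defs
begin

text \<open>The steps \<open>T\<^sub>E\<close> of the walk satisfy \<open>T\<^sub>E T\<^sub>E = T\<^sub>E\<close> and \<open>T\<^sub>E T\<^sub>F T\<^sub>E = T\<^sub>E T\<^sub>F\<close>.  For a function \<open>f\<close> on
  configurations let \<open>\<lambda>(f)\<close> be the total weight of those \<open>E\<close> with \<open>f \<circ> T\<^sub>E = f\<close>.  Then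
  \<open>P f - \<lambda>(f) f\<close> is a combination of functions \<open>f \<circ> T\<^sub>E\<close> with \<open>\<lambda>(f \<circ> T\<^sub>E) > \<lambda>(f)\<close>, so by descending
  induction every \<open>f\<close> is a sum of eigenvectors and \<open>P\<close> is diagonalizable.

  The multiplicities are then determined by the traces of the powers of \<open>P\<close>.  The trace of \<open>P^m\<close> is
  the weighted number of fixed points of the words of length \<open>m\<close>.  A word fixes as many linear orders
  of a set as there are permutations of that set preserving every letter of the word; sorting these
  permutations by their cycle partition expresses the trace through the pairs \<open>(\<alpha>, \<beta>)\<close>.

  If Fib is generated by the steps of positive weight, some word of such steps is constant on
  configurations, which forces an invariant signed measure to have constant sign.\<close>

section \<open>Sums of eigenspaces and traces of powers\<close>


text \<open>Different pairs (\<alpha>, \<beta>) may give the same number, so a root of the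
  characteristic polynomial can only be matched with all pairs of that value together. Hence no
  eigenvector is attached to an individual pair: the traces yield the total multiplicity of each
  value, and the diagonal form turns it into an order of a root. The pairs arise because a step acts
  on the order of the shelves and, separately, on the order of the books of each shelf, so fixed
  points are counted at two levels. The cycles of a permutation of the shelves partition the set
  \<pi>, which amounts to a partition \<alpha> coarser than \<pi>; the cycles of permutations inside
  the shelves give a \<beta> finer than \<pi>. A block of size m carries (m - 1)! cyclic orders,
  whence the two products of factorials. The constant word comes from Fib itself: a configuration,
  seen as an element of Fib, absorbs every configuration on its right, so a factorization of it into
  generators is a word that sends every configuration to it.\<close>

inductive_set eigenspace_sum :: "'a :: field mat \<Rightarrow> 'a set \<Rightarrow> 'a vec set"
  for A :: "'a mat" and \<Lambda> :: "'a set" where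
  zero: "0\<^sub>v (dim_row A) \<in> eigenspace_sum A \<Lambda>"
| add: "v \<in> carrier_vec (dim_row A) \<Longrightarrow> A *\<^sub>v v = k \<cdot>\<^sub>v v \<Longrightarrow> k \<in> \<Lambda> \<Longrightarrow>
    u \<in> eigenspace_sum A \<Lambda> \<Longrightarrow> v + u \<in> eigenspace_sum A \<Lambda>"

lemma eigenspace_sum_carrier:
  "u \<in> eigenspace_sum A \<Lambda> \<Longrightarrow> u \<in> carrier_vec (dim_row A)"
  by (induction rule: eigenspace_sum.induct) auto

lemma eigenspace_sum_mono:
  assumes "u \<in> eigenspace_sum A \<Lambda>" "\<Lambda> \<subseteq> \<Lambda>'"
  shows "u \<in> eigenspace_sum A \<Lambda>'"
  using assms by (induction rule: eigenspace_sum.induct) (auto intro: eigenspace_sum.intros)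

lemma eigenspace_sum_add:
  assumes "u \<in> eigenspace_sum A \<Lambda>" "v \<in> eigenspace_sum A \<Lambda>"
  shows "u + v \<in> eigenspace_sum A \<Lambda>"
  using assms
proof (induction rule: eigenspace_sum.induct)
  case (add x k u)
  then have "x + u + v = x + (u + v)"
    using eigenspace_sum_carrier by (intro assoc_add_vec) auto
  then show ?case using add by (auto intro: eigenspace_sum.add)
next
  case zero
  then show ?case using left_zero_vec[OF eigenspace_sum_carrier[OF zero]] by simp
qed

lemma eigenspace_sum_smult:
  assumes A: "A \<in> carrier_mat n n" and u: "u \<in> eigenspace_sum A \<Lambda>"
  shows "a \<cdot>\<^sub>v u \<in> eigenspace_sum A \<Lambda>"
  using u
proof (induction rule: eigenspace_sum.induct)
  case zero
  have "a \<cdot>\<^sub>v 0\<^sub>v (dim_row A) = 0\<^sub>v (dim_row A)" by (intro eq_vecI) auto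
  then show ?case using eigenspace_sum.zero[of A \<Lambda>] by simp
next
  case (add x k u)
  have "a \<cdot>\<^sub>v (x + u) = a \<cdot>\<^sub>v x + a \<cdot>\<^sub>v u"
    using add eigenspace_sum_carrier by (intro smult_add_distrib_vec) auto
  moreover have "A *\<^sub>v (a \<cdot>\<^sub>v x) = k \<cdot>\<^sub>v (a \<cdot>\<^sub>v x)"
    using A add.hyps by (simp add: mult_mat_vec smult_smult_assoc mult.commute)
  ultimately show ?case using add by (auto intro: eigenspace_sum.add)
qed

text \<open>On an eigenvector for \<open>l\<close> the map \<open>A - k\<close> is multiplication by
  \<open>l - k\<close>, which is nonzero because \<open>l\<close> lies in \<open>\<Lambda>\<close>
  and \<open>k\<close> does not. So \<open>A - k\<close> maps the sum of these eigenspaces onto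
  itself; the set \<open>\<Lambda>\<close> is recorded to make this available.\<close>

lemma eigenspace_sum_resolvent:
  assumes A: "A \<in> carrier_mat n n" and k: "k \<notin> \<Lambda>" and u: "u \<in> eigenspace_sum A \<Lambda>"
  shows "\<exists>s \<in> eigenspace_sum A \<Lambda>. A *\<^sub>v s = k \<cdot>\<^sub>v s + u"
  using u
proof (induction rule: eigenspace_sum.induct)
  case zero
  then show ?case using A by (intro bexI[OF _ eigenspace_sum.zero]) auto
next
  case (add x l u)
  then obtain s where s: "s \<in> eigenspace_sum A \<Lambda>" "A *\<^sub>v s = k \<cdot>\<^sub>v s + u" by blast
  define y where "y = (1 / (l - k)) \<cdot>\<^sub>v x"
  have lk: "l \<noteq> k" using add k by auto
  have car: "x \<in> carrier_vec n" "s \<in> carrier_vec n" "u \<in> carrier_vec n" "y \<in> carrier_vec n"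
    using add s eigenspace_sum_carrier A by (auto simp: y_def)
  have Ay: "A *\<^sub>v y = l \<cdot>\<^sub>v y"
    using A add.hyps(2) car by (simp add: y_def mult_mat_vec smult_smult_assoc mult.commute)
  have "l \<cdot>\<^sub>v y = k \<cdot>\<^sub>v y + x"
    using car lk by (intro eq_vecI) (auto simp: y_def field_simps)
  then have "A *\<^sub>v (y + s) = (k \<cdot>\<^sub>v y + x) + (k \<cdot>\<^sub>v s + u)"
    using A car s Ay by (simp add: mult_add_distrib_mat_vec)
  also have "\<dots> = k \<cdot>\<^sub>v (y + s) + (x + u)"
    using car by (intro eq_vecI) (auto simp: field_simps)
  finally have "A *\<^sub>v (y + s) = k \<cdot>\<^sub>v (y + s) + (x + u)" .
  moreover have "y + s \<in> eigenspace_sum A \<Lambda>"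
    using add.hyps Ay car s A by (intro eigenspace_sum.add[where k = l]) auto
  ultimately show ?case by blast
qed

text \<open>If \<open>s\<close> solves the same equation as \<open>u\<close>, with the same
  remainder \<open>r\<close>, then \<open>u - s\<close> is an eigenvector for \<open>k\<close>, and
  \<open>u\<close> is its sum with \<open>s\<close>. This turns a triangular relation into a
  decomposition.\<close>

lemma eigenspace_sum_insert:
  assumes A: "A \<in> carrier_mat n n" and u: "u \<in> carrier_vec n" and k: "k \<notin> \<Lambda>"
    and r: "r \<in> eigenspace_sum A \<Lambda>" and Au: "A *\<^sub>v u = k \<cdot>\<^sub>v u + r"
  shows "u \<in> eigenspace_sum A (insert k \<Lambda>)"
proof -
  obtain s where s: "s \<in> eigenspace_sum A \<Lambda>" "A *\<^sub>v s = k \<cdot>\<^sub>v s + r"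
    using eigenspace_sum_resolvent[OF A k r] by blast
  have car: "s \<in> carrier_vec n" "r \<in> carrier_vec n"
    using s r eigenspace_sum_carrier A by auto
  have "A *\<^sub>v (u - s) = (k \<cdot>\<^sub>v u + r) - (k \<cdot>\<^sub>v s + r)"
    using A car u s Au by (simp add: mult_minus_distrib_mat_vec)
  also have "\<dots> = k \<cdot>\<^sub>v (u - s)"
    using car u by (intro eq_vecI) (auto simp: field_simps)
  finally have "(u - s) + s \<in> eigenspace_sum A (insert k \<Lambda>)"
    using A car u eigenspace_sum_mono[OF s(1), of "insert k \<Lambda>"]
    by (intro eigenspace_sum.add[where k = k]) auto
  moreover have "(u - s) + s = u" using u car by (intro eq_vecI) auto
  ultimately show ?thesis by simp
qed

text \<open>A maximal independent set of eigenvectors spans every eigenvector, hence by assumption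
  the whole space. Used as the columns of \<open>M\<close>, this basis gives
  \<open>A * M = M * D\<close> with \<open>D\<close> diagonal.\<close>

lemma diagonalizable_mat_if_eigenspace_sum:
  fixes A :: "'a :: field mat"
  assumes A: "A \<in> carrier_mat n n" and sum: "carrier_vec n \<subseteq> eigenspace_sum A UNIV"
  shows "diagonalizable_mat A"
proof -
  interpret vec_space "TYPE('a)" n .
  define S where "S = {v \<in> carrier_vec n. \<exists>k. A *\<^sub>v v = k \<cdot>\<^sub>v v}"
  have S: "S \<subseteq> carrier_vec n" by (auto simp: S_def)
  have "finite T \<and> card T \<le> n" if "T \<subseteq> S \<and> lin_indpt T" for T
    using that S li_le_dim[of T] dim_is_n by auto
  moreover have "{} \<subseteq> S \<and> lin_indpt {}" by (auto simp: lin_dep_def)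
  ultimately obtain U where U: "finite U" "maximal U (\<lambda>T. T \<subseteq> S \<and> lin_indpt T)"
    using maximal_exists[of "\<lambda>T. T \<subseteq> S \<and> lin_indpt T" n "{}"] by blast
  have US: "U \<subseteq> S" and li: "lin_indpt U" using U(2) by (auto simp: maximal_def)
  have Uc: "U \<subseteq> carrier_vec n" using US S by blast
  have S_span: "v \<in> span U" if "v \<in> S" for v
  proof (cases "v \<in> U")
    case True
    then show ?thesis using span_mem[of U] Uc by auto
  next
    case False
    then have "lin_dep (insert v U)"
      using U(2) US that by (auto simp: maximal_def)
    then show ?thesis using lin_dep_iff_in_span[of U v] Uc li that S False by auto
  qed
  have "u \<in> span U" if "u \<in> eigenspace_sum A UNIV" for u
    using that
  proof (induction rule: eigenspace_sum.induct)
    case zero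
    then show ?case using span_empty span_is_monotone[of "{}" U] A by auto
  next
    case (add v k u)
    then have "v \<in> span U" using S_span A by (auto simp: S_def)
    then show ?case using add span_add1[of U v u] Uc by auto
  qed
  then have "span U = carrier_vec n" using sum span_closed[of U] Uc by auto
  then have "basis U" unfolding basis_def using li Uc by auto
  then have cardU: "card U = n" using dim_basis[OF U(1)] dim_is_n by simp
  obtain us where us: "set us = U" "distinct us" using finite_distinct_list[OF U(1)] by blast
  have len: "length us = n" using us cardU distinct_card by fastforce
  define M where "M = mat_of_cols n us"
  have M: "M \<in> carrier_mat n n" using len by (auto simp: M_def)
  have cols: "cols M = us" using us Uc by (auto simp: M_def)
  have "det M \<noteq> 0"
    using det_rank_iff[OF M] lin_indpt_full_rank[OF M] cols us li by auto
  \<comment> \<open>The parameter \<open>b\<close> is the record extension of the matrix ring, so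
    the value \<open>()\<close> is arbitrary.\<close>
  from det_non_zero_imp_unit[OF M this, where b = "()"]
  obtain N where N: "N \<in> carrier_mat n n" "M * N = 1\<^sub>m n" "N * M = 1\<^sub>m n"
    by (auto simp: Units_def ring_mat_def)
  obtain d where d: "\<And>v. v \<in> U \<Longrightarrow> A *\<^sub>v v = d v \<cdot>\<^sub>v v"
  proof -
    have "\<forall>v\<in>U. \<exists>k. A *\<^sub>v v = k \<cdot>\<^sub>v v" using US by (auto simp: S_def)
    from bchoice[OF this] show ?thesis using that by blast
  qed
  define D where "D = mat n n (\<lambda>(i, j). if i = j then d (us ! j) else 0)"
  have D: "D \<in> carrier_mat n n" by (simp add: D_def)
  have "A * M = M * D"
  proof (rule mat_col_eqI)
    fix j assume "j < dim_col (M * D)"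
    then have j: "j < n" using D by simp
    have uj: "us ! j \<in> U" "us ! j \<in> carrier_vec n" using j len us Uc by auto
    have cj: "col M j = us ! j" using j len uj(2) unfolding M_def by (intro col_mat_of_cols) auto
    have "col (A * M) j = d (us ! j) \<cdot>\<^sub>v us ! j"
      using col_mult2[OF A M j] cj d[OF uj(1)] by simp
    moreover have "col (M * D) j = d (us ! j) \<cdot>\<^sub>v us ! j"
    proof (rule eq_vecI)
      fix i assume "i < dim_vec (d (us ! j) \<cdot>\<^sub>v us ! j)"
      then have i: "i < n" using uj by auto
      have "col (M * D) j $ i = (\<Sum>k = 0..<n. M $$ (i, k) * D $$ (k, j))"
        using i j M D by (simp add: scalar_prod_def)
      also have "\<dots> = (\<Sum>k = 0..<n. if k = j then M $$ (i, j) * d (us ! j) else 0)"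
        by (intro sum.cong) (auto simp: D_def j)
      also have "\<dots> = M $$ (i, j) * d (us ! j)" using j by simp
      also have "M $$ (i, j) = us ! j $ i" using arg_cong[OF cj, of "\<lambda>v. v $ i"] M i j by simp
      finally show "col (M * D) j $ i = (d (us ! j) \<cdot>\<^sub>v us ! j) $ i"
        using i uj by (simp add: mult.commute)
    qed (use uj M in auto)
    ultimately show "col (A * M) j = col (M * D) j" by simp
  qed (use A M D in auto)
  then have "M * D * N = A * (M * N)" using assoc_mult_mat[OF A M N(1)] by simp
  then have "A = M * D * N" using A N by simp
  then have "similar_mat A D" using A M N D by (intro similar_matI[of _ _ M N n]) auto
  moreover have "diagonal_mat D" by (auto simp: diagonal_mat_def D_def)
  ultimately show ?thesis unfolding diagonalizable_mat_def by blast
qed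

section \<open>Traces of powers and orders of roots of the characteristic polynomial\<close>

definition mat_trace :: "'a :: comm_monoid_add mat \<Rightarrow> 'a" where
  "mat_trace A = (\<Sum>i < dim_row A. A $$ (i, i))"

lemma mat_trace_mult_commute:
  fixes A :: "'a :: comm_semiring_0 mat"
  assumes "A \<in> carrier_mat n m" "B \<in> carrier_mat m n"
  shows "mat_trace (A * B) = mat_trace (B * A)"
proof -
  have "mat_trace (A * B) = (\<Sum>i<n. \<Sum>k<m. A $$ (i, k) * B $$ (k, i))"
    using assms unfolding mat_trace_def
    by (intro sum.cong) (auto simp: scalar_prod_def atLeast0LessThan)
  also have "\<dots> = (\<Sum>k<m. \<Sum>i<n. B $$ (k, i) * A $$ (i, k))"
    by (subst sum.swap) (simp add: mult.commute)
  also have "\<dots> = mat_trace (B * A)"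
    using assms unfolding mat_trace_def
    by (intro sum.cong) (auto simp: scalar_prod_def atLeast0LessThan)
  finally show ?thesis .
qed

lemma mat_trace_similar:
  fixes A :: "'a :: comm_ring_1 mat"
  assumes "similar_mat_wit A B P Q"
  shows "mat_trace A = mat_trace B"
proof -
  define n where "n = dim_row A"
  note D = similar_mat_witD[OF n_def assms]
  have "mat_trace A = mat_trace (P * (B * Q))"
    using D(3) assoc_mult_mat[OF D(6,5,7)] by simp
  also have "\<dots> = mat_trace ((B * Q) * P)"
    by (intro mat_trace_mult_commute) (use D in auto)
  also have "(B * Q) * P = B" using assoc_mult_mat[OF D(5,7,6)] D(2,5) by simp
  finally show ?thesis .
qed

lemma pow_diagonal_mat:
  fixes D :: "'a :: comm_semiring_1 mat"
  assumes D: "D \<in> carrier_mat n n" "diagonal_mat D" and ij: "i < n" "j < n"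
  shows "(D ^\<^sub>m m) $$ (i, j) = (if i = j then D $$ (i, i) ^ m else 0)"
  using ij
proof (induction m arbitrary: j)
  case 0
  then show ?case using D by simp
next
  case (Suc m)
  have "(D ^\<^sub>m Suc m) $$ (i, j) = (\<Sum>k = 0..<n. (D ^\<^sub>m m) $$ (i, k) * D $$ (k, j))"
    using Suc.prems D by (simp add: scalar_prod_def)
  also have "\<dots> = (\<Sum>k = 0..<n. if k = i then D $$ (i, i) ^ m * D $$ (i, j) else 0)"
    using Suc by (intro sum.cong) auto
  also have "\<dots> = D $$ (i, i) ^ m * D $$ (i, j)" using Suc.prems by simp
  also have "\<dots> = (if i = j then D $$ (i, i) ^ Suc m else 0)"
    using D Suc.prems by (auto simp: diagonal_mat_def mult.commute)
  finally show ?case .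
qed

text \<open>The power sums extend linearly to all polynomials; evaluate at one that vanishes at every
  node except \<open>x\<close>.\<close>

lemma power_sums_eq_imp_mass_eq:
  fixes a :: "'i \<Rightarrow> 'a :: idom" and b :: "'j \<Rightarrow> 'a"
  assumes fin: "finite I" "finite J"
    and eq: "\<And>m. (\<Sum>i\<in>I. k i * a i ^ m) = (\<Sum>j\<in>J. l j * b j ^ m)"
  shows "(\<Sum>i | i \<in> I \<and> a i = x. k i) = (\<Sum>j | j \<in> J \<and> b j = x. l j)"
proof -
  have poly_eq: "(\<Sum>i\<in>I. k i * poly p (a i)) = (\<Sum>j\<in>J. l j * poly p (b j))" for p
  proof -
    have swap: "(\<Sum>i\<in>I. k i * poly p (a i)) = (\<Sum>m\<le>degree p. coeff p m * (\<Sum>i\<in>I. k i * a i ^ m))"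
      for I :: "'c set" and k a
    proof -
      have "(\<Sum>i\<in>I. k i * poly p (a i)) = (\<Sum>i\<in>I. \<Sum>m\<le>degree p. coeff p m * (k i * a i ^ m))"
        by (simp add: poly_altdef sum_distrib_left mult_ac)
      also have "\<dots> = (\<Sum>m\<le>degree p. \<Sum>i\<in>I. coeff p m * (k i * a i ^ m))" by (rule sum.swap)
      finally show ?thesis by (simp add: sum_distrib_left)
    qed
    show ?thesis by (simp only: swap eq)
  qed
  define Z where "Z = a ` I \<union> b ` J - {x}"
  have finZ: "finite Z" using fin by (simp add: Z_def)
  define p where "p = (\<Prod>z\<in>Z. [:- z, 1:])"
  have p0: "poly p z = 0" if "z \<in> Z" for z
    using that finZ by (auto simp: p_def poly_prod)
  have px: "poly p x \<noteq> 0" using finZ by (auto simp: p_def poly_prod Z_def)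
  have 1: "(\<Sum>i\<in>I. k i * poly p (a i)) = (\<Sum>i | i \<in> I \<and> a i = x. k i) * poly p x"
  proof -
    have "(\<Sum>i\<in>I. k i * poly p (a i)) = (\<Sum>i | i \<in> I \<and> a i = x. k i * poly p (a i))"
      using fin p0 by (intro sum.mono_neutral_right) (auto simp: Z_def)
    then show ?thesis by (simp add: sum_distrib_right)
  qed
  have 2: "(\<Sum>j\<in>J. l j * poly p (b j)) = (\<Sum>j | j \<in> J \<and> b j = x. l j) * poly p x"
  proof -
    have "(\<Sum>j\<in>J. l j * poly p (b j)) = (\<Sum>j | j \<in> J \<and> b j = x. l j * poly p (b j))"
      using fin p0 by (intro sum.mono_neutral_right) (auto simp: Z_def)
    then show ?thesis by (simp add: sum_distrib_right)
  qed
  from poly_eq[of p] px show ?thesis unfolding 1 2 by simp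
qed

lemma order_prod_list_linear:
  fixes x :: "'a :: idom"
  shows "order x (\<Prod>a\<leftarrow>as. [:- a, 1:]) = count_list as x"
proof (induction as)
  case (Cons a as)
  have "order x ([:- a, 1:] * (\<Prod>a\<leftarrow>as. [:- a, 1:])) =
      order x [:- a, 1:] + order x (\<Prod>a\<leftarrow>as. [:- a, 1:])"
    by (rule order_mult) (auto simp: prod_list_zero_iff simp del: mult_pCons_left)
  moreover have "order x [:- a, 1:] = (if a = x then 1 else 0)"
    by (auto simp: order_linear')
  ultimately show ?case using Cons by simp
qed simp

text \<open>The traces are the power sums of the diagonal entries of a diagonal form, and power sums
  determine how much mass sits at \<open>x\<close>. In characteristic 0 that mass is an honest
  count, and for a triangular matrix the count of \<open>x\<close> on the diagonal is the order of
  the root.\<close>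

lemma order_char_poly_if_traces:
  fixes A :: "'a :: field_char_0 mat"
  assumes A: "A \<in> carrier_mat n n" and diag: "diagonalizable_mat A" and J: "finite J"
    and tr: "\<And>m. mat_trace (A ^\<^sub>m m) = (\<Sum>j\<in>J. of_nat (k j) * b j ^ m)"
  shows "order x (char_poly A) = (\<Sum>j | j \<in> J \<and> b j = x. k j)"
proof -
  obtain D where D: "diagonal_mat D" "similar_mat A D"
    using diag by (auto simp: diagonalizable_mat_def)
  then obtain P Q where PQ: "similar_mat_wit A D P Q" by (auto simp: similar_mat_def)
  have Dc: "D \<in> carrier_mat n n" using similar_mat_witD(5)[OF _ PQ, of n] A by simp
  have "mat_trace (A ^\<^sub>m m) = (\<Sum>i<n. 1 * D $$ (i, i) ^ m)" for m
  proof -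
    have "mat_trace (A ^\<^sub>m m) = mat_trace (D ^\<^sub>m m)"
      by (rule mat_trace_similar[OF similar_mat_wit_pow[OF PQ]])
    also have "\<dots> = (\<Sum>i<n. D $$ (i, i) ^ m)"
      unfolding mat_trace_def using Dc D(1) pow_diagonal_mat[OF Dc D(1)] by (intro sum.cong) auto
    finally show ?thesis by simp
  qed
  then have "(\<Sum>i<n. 1 * D $$ (i, i) ^ m) = (\<Sum>j\<in>J. of_nat (k j) * b j ^ m)" for m
    by (simp only: tr[symmetric])
  from power_sums_eq_imp_mass_eq[OF finite_lessThan J this, of x]
  have "(of_nat (card {i. i < n \<and> D $$ (i, i) = x}) :: 'a) = of_nat (\<Sum>j | j \<in> J \<and> b j = x. k j)"
    by simp
  then have card: "card {i. i < n \<and> D $$ (i, i) = x} = (\<Sum>j | j \<in> J \<and> b j = x. k j)"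
    by (simp only: of_nat_eq_iff)
  have "upper_triangular D" using D(1) Dc by (auto simp: diagonal_mat_def upper_triangular_def)
  then have "char_poly A = (\<Prod>a\<leftarrow>diag_mat D. [:- a, 1:])"
    using char_poly_similar[OF D(2)] char_poly_upper_triangular[OF Dc] by simp
  then have "order x (char_poly A) = count_list (diag_mat D) x"
    by (simp add: order_prod_list_linear)
  also have "\<dots> = length (filter ((=) x) (map (\<lambda>i. D $$ (i, i)) [0..<n]))"
    using Dc by (simp add: count_list_eq_length_filter diag_mat_def)
  also have "\<dots> = card {i. i < n \<and> D $$ (i, i) = x}"
    unfolding length_filter_conv_card by (intro arg_cong[of _ _ card]) auto
  finally show ?thesis using card by simp
qed

section \<open>Walks driven by left regular bands\<close>


text \<open>When the weights are probabilities this is the expectation of \<open>F\<close> on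
  \<open>m\<close> independent letters. The recursion peels off the first letter, which is the one
  that \<open>foldr\<close> applies last.\<close>

primrec word_sum :: "'i set \<Rightarrow> ('i \<Rightarrow> real) \<Rightarrow> nat \<Rightarrow> ('i list \<Rightarrow> real) \<Rightarrow> real" where
  "word_sum I w 0 F = F []"
| "word_sum I w (Suc m) F = (\<Sum>i\<in>I. w i * word_sum I w m (\<lambda>is. F (i # is)))"

lemma word_sum_cong:
  assumes "\<And>is. set is \<subseteq> I \<Longrightarrow> F is = G is"
  shows "word_sum I w m F = word_sum I w m G"
  using assms
proof (induction m arbitrary: F G)
  case (Suc m)
  have "word_sum I w m (\<lambda>is. F (i # is)) = word_sum I w m (\<lambda>is. G (i # is))" if "i \<in> I" for i
    using that Suc.prems by (intro Suc.IH) auto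
  then show ?case by simp
qed simp

lemma word_sum_scale: "word_sum I w m (\<lambda>is. k * F is) = k * word_sum I w m F"
  by (induction m arbitrary: F) (simp_all add: sum_distrib_left mult.left_commute)

lemma word_sum_sum:
  "word_sum I w m (\<lambda>is. \<Sum>j\<in>J. F j is) = (\<Sum>j\<in>J. word_sum I w m (F j))"
proof (induction m arbitrary: F)
  case (Suc m)
  show ?case by (simp add: Suc.IH sum_distrib_left) (rule sum.swap)
qed simp

text \<open>An indicator that tests every letter is a product over the letters, so the sum factors.
  This is the source of the m-th powers of the eigenvalues.\<close>

lemma word_sum_of_bool_all:
  assumes "finite I"
  shows "word_sum I w m (\<lambda>is. of_bool (\<forall>i\<in>set is. Q i)) = (\<Sum>i | i \<in> I \<and> Q i. w i) ^ m"
proof (induction m)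
  case (Suc m)
  have "word_sum I w (Suc m) (\<lambda>is. of_bool (\<forall>i\<in>set is. Q i)) =
      (\<Sum>i\<in>I. w i * word_sum I w m (\<lambda>is. of_bool (Q i) * of_bool (\<forall>i\<in>set is. Q i)))"
    by (simp add: of_bool_conj)
  also have "\<dots> = (\<Sum>i\<in>I. (if Q i then w i else 0) * (\<Sum>i | i \<in> I \<and> Q i. w i) ^ m)"
    unfolding word_sum_scale Suc.IH by (intro sum.cong) auto
  also have "\<dots> = (\<Sum>i | i \<in> I \<and> Q i. w i) ^ Suc m"
    using assms by (simp add: sum_distrib_right[symmetric] sum.inter_filter)
  finally show ?case .
qed simp

lemma sum_nth_distinct:
  assumes "distinct xs"
  shows "(\<Sum>a<length xs. g (xs ! a)) = (\<Sum>x\<in>set xs. g x)"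
  using sum.reindex_bij_betw[OF bij_betw_nth[OF assms refl refl], of g] by simp

text \<open>The triangle inequality gives one direction at every coordinate. Since the rows sum to
  1, both sides have the same total over all coordinates, so none of these inequalities can be
  strict.\<close>

lemma stochastic_invariant_abs:
  fixes p :: "nat \<Rightarrow> nat \<Rightarrow> real"
  assumes nonneg: "\<And>a b. a < N \<Longrightarrow> b < N \<Longrightarrow> 0 \<le> p a b"
    and rows: "\<And>a. a < N \<Longrightarrow> (\<Sum>b<N. p a b) = 1"
    and inv: "\<And>b. b < N \<Longrightarrow> (\<Sum>a<N. p a b * v a) = v b"
    and b: "b < N"
  shows "(\<Sum>a<N. p a b * \<bar>v a\<bar>) = \<bar>v b\<bar>"
proof -
  have le: "\<bar>v b\<bar> \<le> (\<Sum>a<N. p a b * \<bar>v a\<bar>)" if "b < N" for b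
  proof -
    have "\<bar>v b\<bar> \<le> (\<Sum>a<N. \<bar>p a b * v a\<bar>)"
      unfolding inv[OF that, symmetric] by (rule sum_abs)
    also have "\<dots> = (\<Sum>a<N. p a b * \<bar>v a\<bar>)"
      using nonneg that by (intro sum.cong) (auto simp: abs_mult)
    finally show ?thesis .
  qed
  have "(\<Sum>b<N. \<Sum>a<N. p a b * \<bar>v a\<bar>) = (\<Sum>a<N. (\<Sum>b<N. p a b) * \<bar>v a\<bar>)"
    by (subst sum.swap) (simp add: sum_distrib_right)
  also have "\<dots> = (\<Sum>b<N. \<bar>v b\<bar>)" using rows by simp
  finally have "(\<Sum>b<N. \<bar>v b\<bar>) = (\<Sum>b<N. \<Sum>a<N. p a b * \<bar>v a\<bar>)" by simp
  from sum_mono_inv[OF this, of b] show ?thesis using le b by simp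
qed

section \<open>Walks given by an idempotent left regular action\<close>

text \<open>The identities of a left regular band are imposed on the action on the states rather
  than on an abstract semigroup, because the library steps satisfy them as maps.\<close>

locale lrb_walk =
  fixes cs :: "'c list" and I :: "'i set" and act :: "'i \<Rightarrow> 'c \<Rightarrow> 'c" and w :: "'i \<Rightarrow> real"
  assumes distinct_cs: "distinct cs"
    and finite_I: "finite I"
    and w_nonneg: "i \<in> I \<Longrightarrow> 0 \<le> w i"
    and act_closed: "i \<in> I \<Longrightarrow> c \<in> set cs \<Longrightarrow> act i c \<in> set cs"
    and act_idem: "i \<in> I \<Longrightarrow> c \<in> set cs \<Longrightarrow> act i (act i c) = act i c"
    and act_left_regular:
      "i \<in> I \<Longrightarrow> j \<in> I \<Longrightarrow> c \<in> set cs \<Longrightarrow> act i (act j (act i c)) = act i (act j c)"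
begin

definition walk_mat :: "real mat" where
  "walk_mat = mat (length cs) (length cs) (\<lambda>(a, b). \<Sum>i | i \<in> I \<and> act i (cs ! a) = cs ! b. w i)"

definition fun_vec :: "('c \<Rightarrow> real) \<Rightarrow> real vec" where
  "fun_vec f = vec (length cs) (\<lambda>a. f (cs ! a))"

lemma walk_mat_carrier [simp]: "walk_mat \<in> carrier_mat (length cs) (length cs)"
  by (simp add: walk_mat_def)

lemma dim_walk_mat [simp]: "dim_row walk_mat = length cs" "dim_col walk_mat = length cs"
  by (simp_all add: walk_mat_def)

lemma fun_vec_carrier [simp]: "fun_vec f \<in> carrier_vec (length cs)"
  by (simp add: fun_vec_def)

lemma fun_vec_cases:
  assumes "v \<in> carrier_vec (length cs)"
  obtains f where "v = fun_vec f"
proof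
  show "v = fun_vec (\<lambda>c. v $ (THE a. a < length cs \<and> cs ! a = c))"
  proof (rule eq_vecI)
    fix a assume "a < dim_vec (fun_vec (\<lambda>c. v $ (THE a. a < length cs \<and> cs ! a = c)))"
    then have a: "a < length cs" by (simp add: fun_vec_def)
    then have "(THE b. b < length cs \<and> cs ! b = cs ! a) = a"
      using distinct_cs nth_eq_iff_index_eq by (intro the_equality) auto
    then show "v $ a = fun_vec (\<lambda>c. v $ (THE a. a < length cs \<and> cs ! a = c)) $ a"
      using a by (simp add: fun_vec_def)
  qed (use assms in \<open>auto simp: fun_vec_def\<close>)
qed

lemma walk_mat_mult_fun_vec:
  "walk_mat *\<^sub>v fun_vec f = fun_vec (\<lambda>c. \<Sum>i\<in>I. w i * f (act i c))"
proof (rule eq_vecI)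
  fix a assume "a < dim_vec (fun_vec (\<lambda>c. \<Sum>i\<in>I. w i * f (act i c)))"
  then have a: "a < length cs" by (simp add: fun_vec_def)
  have "(walk_mat *\<^sub>v fun_vec f) $ a =
      (\<Sum>b<length cs. (\<Sum>i | i \<in> I \<and> act i (cs ! a) = cs ! b. w i) * f (cs ! b))"
    using a by (simp add: walk_mat_def fun_vec_def scalar_prod_def atLeast0LessThan)
  also have "\<dots> = (\<Sum>d\<in>set cs. (\<Sum>i | i \<in> I \<and> act i (cs ! a) = d. w i) * f d)"
    by (rule sum_nth_distinct[OF distinct_cs])
  also have "\<dots> = (\<Sum>d\<in>set cs. \<Sum>i\<in>I. if act i (cs ! a) = d then w i * f d else 0)"
    using finite_I by (simp add: sum_distrib_right sum.inter_filter) (intro sum.cong, auto)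
  also have "\<dots> = (\<Sum>i\<in>I. \<Sum>d\<in>set cs. if act i (cs ! a) = d then w i * f d else 0)"
    by (rule sum.swap)
  also have "\<dots> = (\<Sum>i\<in>I. w i * f (act i (cs ! a)))"
    using act_closed a by (intro sum.cong) auto
  finally show "(walk_mat *\<^sub>v fun_vec f) $ a = fun_vec (\<lambda>c. \<Sum>i\<in>I. w i * f (act i c)) $ a"
    using a by (simp add: fun_vec_def)
qed (simp add: fun_vec_def walk_mat_def)

definition stab :: "('c \<Rightarrow> real) \<Rightarrow> 'i set" where
  "stab f = {i \<in> I. \<forall>c\<in>set cs. f (act i c) = f c}"

text \<open>For \<open>j\<close> in the stabilizer, \<open>f\<close> may be preceded by
  \<open>act j\<close> at no cost; left regularity then deletes the inner \<open>act j\<close> in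
  \<open>act j (act i (act j c))\<close>, and the outer one is dropped again. That \<open>i\<close>
  itself joins the stabilizer is idempotence.\<close>

lemma stab_comp_act:
  assumes "i \<in> I"
  shows "stab f \<subseteq> stab (\<lambda>c. f (act i c))" and "i \<in> stab (\<lambda>c. f (act i c))"
proof -
  have "f (act i (act j c)) = f (act i c)" if j: "j \<in> stab f" and c: "c \<in> set cs" for j c
  proof -
    have jI: "j \<in> I" and f: "\<And>c. c \<in> set cs \<Longrightarrow> f (act j c) = f c"
      using j by (auto simp: stab_def)
    have "f (act i (act j c)) = f (act j (act i (act j c)))"
      using f act_closed assms jI c by simp
    also have "\<dots> = f (act j (act i c))" using act_left_regular[OF jI assms c] by simp
    also have "\<dots> = f (act i c)" using f act_closed assms c by simp
    finally show ?thesis .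
  qed
  then show "stab f \<subseteq> stab (\<lambda>c. f (act i c))" by (auto simp: stab_def)
  show "i \<in> stab (\<lambda>c. f (act i c))" using assms act_idem by (auto simp: stab_def)
qed

text \<open>The walk maps \<open>f\<close> to \<open>sum w (stab f)\<close> times \<open>f\<close> plus a combination of functions with strictly
  larger stabilizers.  Nonnegativity of the weights makes the corresponding eigenvalues strictly
  larger, so they can be solved for.\<close>

lemma fun_vec_eigenspace_sum:
  "fun_vec f \<in> eigenspace_sum walk_mat {sum w (stab f)..}"
proof (induction "card (I - stab f)" arbitrary: f rule: less_induct)
  case less
  let ?k = "sum w (stab f)"
  have dim: "dim_row walk_mat = length cs" by (simp add: walk_mat_def)
  \<comment> \<open>The half-line is open on purpose: \<open>?k\<close> must not occur among the
    eigenvalues of the remainder, since otherwise the equation for the correction term could not be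
    solved.\<close>
  have rest: "fun_vec (\<lambda>c. \<Sum>i\<in>J. w i * f (act i c)) \<in> eigenspace_sum walk_mat {?k<..}"
    if "finite J" "J \<subseteq> I - stab f" for J
    using that
  proof (induction J rule: finite_induct)
    case empty
    have "fun_vec (\<lambda>c. 0) = 0\<^sub>v (dim_row walk_mat)"
      by (intro eq_vecI) (auto simp: fun_vec_def dim)
    then show ?case using eigenspace_sum.zero[of walk_mat] by simp
  next
    case (insert i J)
    then have i: "i \<in> I" "i \<notin> stab f" by auto
    let ?g = "\<lambda>c. f (act i c)"
    have psub: "stab f \<subset> stab ?g" using stab_comp_act[OF i(1), of f] i(2) by auto
    show ?case
    \<comment> \<open>A letter of weight zero may enlarge the stabilizer without increasing its
      weight, but its summand vanishes.\<close>
    proof (cases "w i = 0")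
      case True
      then show ?thesis using insert by simp
    next
      case False
      then have wi: "w i > 0" using w_nonneg i by force
      have "card (I - stab ?g) < card (I - stab f)"
      proof (rule psubset_card_mono)
        show "I - stab ?g \<subset> I - stab f" using psub i stab_comp_act(2)[OF i(1), of f] by auto
      qed (use finite_I in auto)
      from less.hyps[OF this] have 1: "fun_vec ?g \<in> eigenspace_sum walk_mat {sum w (stab ?g)..}" .
      have fin: "finite (stab ?g)" using finite_I by (auto simp: stab_def)
      have "?k < sum w (stab ?g)"
        using psub wi i stab_comp_act(2)[OF i(1), of f] w_nonneg fin
        by (intro sum_strict_mono2[where b = i]) (auto simp: stab_def)
      then have "fun_vec ?g \<in> eigenspace_sum walk_mat {?k<..}"
        by (intro eigenspace_sum_mono[OF 1]) auto
      then have "w i \<cdot>\<^sub>v fun_vec ?g \<in> eigenspace_sum walk_mat {?k<..}"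
        by (rule eigenspace_sum_smult[OF walk_mat_carrier])
      moreover have "fun_vec (\<lambda>c. \<Sum>i\<in>J. w i * f (act i c)) \<in> eigenspace_sum walk_mat {?k<..}"
        using insert by simp
      ultimately have "w i \<cdot>\<^sub>v fun_vec ?g + fun_vec (\<lambda>c. \<Sum>i\<in>J. w i * f (act i c))
          \<in> eigenspace_sum walk_mat {?k<..}"
        by (rule eigenspace_sum_add)
      moreover have "fun_vec (\<lambda>c. \<Sum>i\<in>insert i J. w i * f (act i c)) =
          w i \<cdot>\<^sub>v fun_vec ?g + fun_vec (\<lambda>c. \<Sum>i\<in>J. w i * f (act i c))"
        using insert.hyps by (intro eq_vecI) (auto simp: fun_vec_def)
      ultimately show ?thesis by simp
    qed
  qed
  have split: "(\<Sum>i\<in>I. w i * f (act i c)) = ?k * f c + (\<Sum>i\<in>I - stab f. w i * f (act i c))"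
    if c: "c \<in> set cs" for c
  proof -
    have "(\<Sum>i\<in>I. w i * f (act i c)) =
        (\<Sum>i\<in>stab f. w i * f (act i c)) + (\<Sum>i\<in>I - stab f. w i * f (act i c))"
      using sum.subset_diff[of "stab f" I] finite_I by (simp add: add.commute stab_def)
    also have "(\<Sum>i\<in>stab f. w i * f (act i c)) = (\<Sum>i\<in>stab f. w i * f c)"
      using c by (intro sum.cong) (auto simp: stab_def)
    finally show ?thesis by (simp add: sum_distrib_right)
  qed
  have "walk_mat *\<^sub>v fun_vec f =
      ?k \<cdot>\<^sub>v fun_vec f + fun_vec (\<lambda>c. \<Sum>i\<in>I - stab f. w i * f (act i c))"
    unfolding walk_mat_mult_fun_vec by (intro eq_vecI) (auto simp: fun_vec_def split)
  from eigenspace_sum_insert[OF walk_mat_carrier fun_vec_carrier _ rest this]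
  have "fun_vec f \<in> eigenspace_sum walk_mat (insert ?k {?k<..})"
    using finite_I by simp
  then show ?case by (rule eigenspace_sum_mono) auto
qed

theorem walk_mat_diagonalizable: "diagonalizable_mat walk_mat"
proof (rule diagonalizable_mat_if_eigenspace_sum[OF walk_mat_carrier], rule subsetI)
  fix v :: "real vec" assume "v \<in> carrier_vec (length cs)"
  then obtain f where "v = fun_vec f" by (rule fun_vec_cases)
  then show "v \<in> eigenspace_sum walk_mat UNIV"
    using eigenspace_sum_mono[OF fun_vec_eigenspace_sum] by blast
qed

lemma pow_walk_mat_mult_fun_vec:
  "(walk_mat ^\<^sub>m m) *\<^sub>v fun_vec f = fun_vec (\<lambda>c. word_sum I w m (\<lambda>is. f (foldr act is c)))"
proof (induction m arbitrary: f)
  case 0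
  show ?case using one_mult_mat_vec[OF fun_vec_carrier] by (simp add: walk_mat_def)
next
  case (Suc m)
  have "(walk_mat ^\<^sub>m Suc m) *\<^sub>v fun_vec f = (walk_mat ^\<^sub>m m) *\<^sub>v (walk_mat *\<^sub>v fun_vec f)"
    unfolding pow_mat.simps
    by (rule assoc_mult_mat_vec[OF pow_carrier_mat[OF walk_mat_carrier] walk_mat_carrier fun_vec_carrier])
  also have "\<dots> = fun_vec (\<lambda>c. word_sum I w m (\<lambda>is. \<Sum>i\<in>I. w i * f (act i (foldr act is c))))"
    by (simp add: walk_mat_mult_fun_vec Suc.IH)
  finally show ?case by (simp add: word_sum_sum word_sum_scale)
qed

text \<open>The diagonal entry at a state is found by applying the power to the indicator function
  of that state and evaluating there: it is the total weight of the words that carry the state back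
  to itself.\<close>

theorem trace_pow_walk_mat:
  "mat_trace (walk_mat ^\<^sub>m m) =
     word_sum I w m (\<lambda>is. real (card {c \<in> set cs. foldr act is c = c}))"
proof -
  have entry: "(walk_mat ^\<^sub>m m) $$ (a, a) =
      word_sum I w m (\<lambda>is. of_bool (foldr act is (cs ! a) = cs ! a))" if a: "a < length cs" for a
  proof -
    have car: "walk_mat ^\<^sub>m m \<in> carrier_mat (length cs) (length cs)"
      by (intro pow_carrier_mat walk_mat_carrier)
    have "unit_vec (length cs) a = fun_vec (\<lambda>c. of_bool (c = cs ! a))"
      using a distinct_cs by (intro eq_vecI) (auto simp: fun_vec_def nth_eq_iff_index_eq)
    then have "(walk_mat ^\<^sub>m m) *\<^sub>v unit_vec (length cs) a =
        fun_vec (\<lambda>c. word_sum I w m (\<lambda>is. of_bool (foldr act is c = cs ! a)))"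
      using pow_walk_mat_mult_fun_vec by simp
    moreover have "((walk_mat ^\<^sub>m m) *\<^sub>v unit_vec (length cs) a) $ a = (walk_mat ^\<^sub>m m) $$ (a, a)"
      using carrier_matD[OF car] a by simp
    ultimately show ?thesis using a by (simp add: fun_vec_def)
  qed
  have "mat_trace (walk_mat ^\<^sub>m m) =
      (\<Sum>a<length cs. word_sum I w m (\<lambda>is. of_bool (foldr act is (cs ! a) = cs ! a)))"
    unfolding mat_trace_def using entry pow_carrier_mat[OF walk_mat_carrier, of m]
    by (intro sum.cong) auto
  also have "\<dots> = (\<Sum>c\<in>set cs. word_sum I w m (\<lambda>is. of_bool (foldr act is c = c)))"
    by (rule sum_nth_distinct[OF distinct_cs])
  also have "\<dots> = word_sum I w m (\<lambda>is. \<Sum>c\<in>set cs. of_bool (foldr act is c = c))"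
    by (rule word_sum_sum[symmetric])
  also have "\<dots> = word_sum I w m (\<lambda>is. real (card {c \<in> set cs. foldr act is c = c}))"
    by (simp add: Int_def)
  finally show ?thesis .
qed

section \<open>Stationary distributions of the walk\<close>

lemma walk_mat_nonneg: "a < length cs \<Longrightarrow> b < length cs \<Longrightarrow> 0 \<le> walk_mat $$ (a, b)"
  using w_nonneg by (auto simp: walk_mat_def intro: sum_nonneg)

lemma walk_mat_row_sum:
  assumes "sum w I = 1" "a < length cs"
  shows "(\<Sum>b<length cs. walk_mat $$ (a, b)) = 1"
proof -
  have "(\<Sum>b<length cs. walk_mat $$ (a, b)) = (walk_mat *\<^sub>v fun_vec (\<lambda>_. 1)) $ a"
    using assms by (simp add: walk_mat_def fun_vec_def scalar_prod_def atLeast0LessThan)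
  then show ?thesis using assms by (simp add: walk_mat_mult_fun_vec) (simp add: fun_vec_def)
qed

lemma transpose_walk_mat_fixed_iff:
  assumes "v \<in> carrier_vec (length cs)"
  shows "transpose_mat walk_mat *\<^sub>v v = v \<longleftrightarrow>
    (\<forall>b<length cs. (\<Sum>a<length cs. walk_mat $$ (a, b) * v $ a) = v $ b)"
proof -
  have "(transpose_mat walk_mat *\<^sub>v v) $ b = (\<Sum>a<length cs. walk_mat $$ (a, b) * v $ a)"
    if "b < length cs" for b
    using that assms by (simp add: walk_mat_def scalar_prod_def atLeast0LessThan)
  moreover have "dim_vec (transpose_mat walk_mat *\<^sub>v v) = length cs" by (simp add: walk_mat_def)
  ultimately show ?thesis using assms by (auto simp: vec_eq_iff)
qed

text \<open>The entrywise absolute value of an eigenvector of the transpose for \<open>1\<close> is again one.\<close>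

lemma stationary_distribution_exists:
  assumes w: "sum w I = 1" and ne: "cs \<noteq> []"
  shows "\<exists>\<mu>. stationary_distribution walk_mat \<mu>"
proof -
  let ?N = "length cs"
  let ?T = "transpose_mat walk_mat"
  have "walk_mat *\<^sub>v fun_vec (\<lambda>_. 1) = 1 \<cdot>\<^sub>v fun_vec (\<lambda>_. 1)"
    using w by (simp add: walk_mat_mult_fun_vec)
  moreover have "fun_vec (\<lambda>_. 1) \<noteq> 0\<^sub>v ?N"
  proof
    assume "fun_vec (\<lambda>_. 1) = 0\<^sub>v ?N"
    from arg_cong[OF this, of "\<lambda>v. v $ 0"] ne show False by (simp add: fun_vec_def)
  qed
  ultimately have "eigenvalue walk_mat 1"
    unfolding eigenvalue_def eigenvector_def using walk_mat_carrier
    by (intro exI[of _ "fun_vec (\<lambda>_. 1)"]) (auto simp: walk_mat_def)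
  \<comment> \<open>The constant function is an eigenvector of the matrix itself; the eigenvalue
    passes to the transpose because both have the same characteristic polynomial.\<close>
  then have "eigenvalue ?T 1"
    using eigenvalue_root_char_poly[OF walk_mat_carrier]
      eigenvalue_root_char_poly[of ?T ?N] char_poly_transpose_mat[OF walk_mat_carrier] by simp
  then obtain v where v: "v \<in> carrier_vec ?N" "v \<noteq> 0\<^sub>v ?N" "?T *\<^sub>v v = 1 \<cdot>\<^sub>v v"
    unfolding eigenvalue_def eigenvector_def by (auto simp: walk_mat_def)
  then have inv: "(\<Sum>a<?N. walk_mat $$ (a, b) * v $ a) = v $ b" if "b < ?N" for b
    using transpose_walk_mat_fixed_iff[OF v(1)] that by simp
  have inv_abs: "(\<Sum>a<?N. walk_mat $$ (a, b) * \<bar>v $ a\<bar>) = \<bar>v $ b\<bar>" if "b < ?N" for b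
    by (rule stochastic_invariant_abs[OF walk_mat_nonneg walk_mat_row_sum[OF w] inv that])
  define t where "t = (\<Sum>a<?N. \<bar>v $ a\<bar>)"
  have "\<exists>a<?N. v $ a \<noteq> 0" using v by (auto simp: vec_eq_iff)
  then have t: "t > 0"
    unfolding t_def by (meson abs_ge_zero finite_lessThan lessThan_iff sum_pos2 zero_less_abs_iff)
  define \<mu> where "\<mu> = vec ?N (\<lambda>a. \<bar>v $ a\<bar> / t)"
  have "(\<Sum>a<?N. walk_mat $$ (a, b) * (\<bar>v $ a\<bar> / t)) = \<bar>v $ b\<bar> / t" if "b < ?N" for b
    using inv_abs[OF that] by (simp add: sum_divide_distrib[symmetric])
  then have "?T *\<^sub>v \<mu> = \<mu>"
    using transpose_walk_mat_fixed_iff[of \<mu>] by (simp add: \<mu>_def)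
  moreover have "(\<Sum>a<?N. \<bar>v $ a\<bar> / t) = 1"
    using t by (simp add: sum_divide_distrib[symmetric] t_def[symmetric])
  ultimately have "stationary_distribution walk_mat \<mu>"
    using t unfolding stationary_distribution_def by (simp add: walk_mat_def \<mu>_def)
  then show ?thesis by blast
qed

lemma foldr_act_closed: "set is \<subseteq> I \<Longrightarrow> c \<in> set cs \<Longrightarrow> foldr act is c \<in> set cs"
  by (induction "is") (auto intro: act_closed)

text \<open>The value of an invariant \<open>g\<close> at a state is the sum of its nonnegative
  inflows. If it vanishes, \<open>g\<close> vanishes at every state with a positive transition into
  that state; the word is followed backwards letter by letter.\<close>

lemma invariant_zero_backwards:
  assumes g: "\<And>a. a < length cs \<Longrightarrow> 0 \<le> g a"
    and inv: "\<And>b. b < length cs \<Longrightarrow> (\<Sum>a<length cs. walk_mat $$ (a, b) * g a) = g b"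
    and "set is \<subseteq> {i \<in> I. w i > 0}" "a < length cs" "b < length cs"
    and "cs ! b = foldr act is (cs ! a)" "g b = 0"
  shows "g a = 0"
  using assms(3-)
proof (induction "is" arbitrary: b)
  case Nil
  then have "a = b" using distinct_cs nth_eq_iff_index_eq by fastforce
  then show ?case using Nil by simp
next
  case (Cons i "is")
  have "foldr act is (cs ! a) \<in> set cs" using Cons.prems by (intro foldr_act_closed) auto
  then obtain d where d: "d < length cs" "cs ! d = foldr act is (cs ! a)"
    by (metis in_set_conv_nth)
  have nn: "0 \<le> walk_mat $$ (x, b) * g x" if "x < length cs" for x
    using that walk_mat_nonneg Cons.prems g by simp
  have "(\<Sum>x<length cs. walk_mat $$ (x, b) * g x) = 0" using inv Cons.prems by simp
  then have "walk_mat $$ (d, b) * g d = 0"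
    using d nn by (subst (asm) sum_nonneg_eq_0_iff) auto
  moreover have "walk_mat $$ (d, b) > 0"
  proof -
    have "w i \<le> (\<Sum>j | j \<in> I \<and> act j (cs ! d) = cs ! b. w j)"
      using Cons.prems d finite_I w_nonneg by (intro member_le_sum) auto
    then show ?thesis using Cons.prems d by (auto simp: walk_mat_def)
  qed
  ultimately have "g d = 0" by simp
  then show ?case using Cons d by auto
qed

text \<open>The difference \<delta> of the two distributions is invariant, and so is its absolute
  value. With \<open>s\<close> the sign of \<delta> at the target \<open>c0\<close> of the word,
  \<open>\<bar>\<delta> a\<bar> - s * \<delta> a\<close> is a nonnegative invariant function
  vanishing at \<open>c0\<close>, which every state reaches, so it is zero. Thus \<delta> has
  constant sign, and its total is 0.\<close>

lemma stationary_distribution_unique: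
  assumes w: "sum w I = 1" and "is": "set is \<subseteq> {i \<in> I. w i > 0}"
    and const: "\<And>c. c \<in> set cs \<Longrightarrow> foldr act is c = c0"
    and \<mu>: "stationary_distribution walk_mat \<mu>" and \<nu>: "stationary_distribution walk_mat \<nu>"
  shows "\<mu> = \<nu>"
proof -
  let ?N = "length cs"
  have dim: "dim_row walk_mat = ?N" by (simp add: walk_mat_def)
  have car: "\<mu> \<in> carrier_vec ?N" "\<nu> \<in> carrier_vec ?N"
    using \<mu> \<nu> by (auto simp: stationary_distribution_def dim)
  define \<delta> where "\<delta> a = \<mu> $ a - \<nu> $ a" for a
  have sum0: "(\<Sum>a<?N. \<delta> a) = 0"
    using \<mu> \<nu> by (simp add: stationary_distribution_def dim \<delta>_def sum_subtractf)
  have inv: "(\<Sum>a<?N. walk_mat $$ (a, b) * \<delta> a) = \<delta> b" if "b < ?N" for b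
    using that \<mu> \<nu> car transpose_walk_mat_fixed_iff[of \<mu>] transpose_walk_mat_fixed_iff[of \<nu>]
    by (simp add: stationary_distribution_def \<delta>_def right_diff_distrib sum_subtractf)
  have inv_abs: "(\<Sum>a<?N. walk_mat $$ (a, b) * \<bar>\<delta> a\<bar>) = \<bar>\<delta> b\<bar>" if "b < ?N" for b
    by (rule stochastic_invariant_abs[OF walk_mat_nonneg walk_mat_row_sum[OF w] inv that])
  have ne: "cs \<noteq> []"
    using \<mu> by (auto simp: stationary_distribution_def dim)
  then have "foldr act is (hd cs) \<in> set cs" using "is" by (intro foldr_act_closed) auto
  then have "c0 \<in> set cs" using const ne by simp
  then obtain b where b: "b < ?N" "cs ! b = c0" by (metis in_set_conv_nth)
  have zero: "\<forall>a<?N. g a = 0"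
    if "\<And>a. a < ?N \<Longrightarrow> 0 \<le> g a"
      and "\<And>b. b < ?N \<Longrightarrow> (\<Sum>a<?N. walk_mat $$ (a, b) * g a) = g b" and "g b = 0" for g
    using invariant_zero_backwards[OF that(1,2) "is" _ b(1) _ that(3)] b const by simp
  have sign: "\<forall>a<?N. \<bar>\<delta> a\<bar> = s * \<delta> a" if "\<bar>\<delta> b\<bar> = s * \<delta> b" "\<bar>s\<bar> = 1" for s
  proof -
    have "\<forall>a<?N. \<bar>\<delta> a\<bar> - s * \<delta> a = 0"
    proof (rule zero)
      fix a show "0 \<le> \<bar>\<delta> a\<bar> - s * \<delta> a"
        using that(2) abs_mult[of s "\<delta> a"] by (simp add: abs_le_iff)
    next
      fix b assume b: "b < ?N"
      have "(\<Sum>a<?N. walk_mat $$ (a, b) * (\<bar>\<delta> a\<bar> - s * \<delta> a)) =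
          (\<Sum>a<?N. walk_mat $$ (a, b) * \<bar>\<delta> a\<bar>) - s * (\<Sum>a<?N. walk_mat $$ (a, b) * \<delta> a)"
        by (simp add: right_diff_distrib sum_subtractf sum_distrib_left mult.left_commute)
      then show "(\<Sum>a<?N. walk_mat $$ (a, b) * (\<bar>\<delta> a\<bar> - s * \<delta> a)) = \<bar>\<delta> b\<bar> - s * \<delta> b"
        using inv inv_abs b by simp
    qed (use that in simp)
    then show ?thesis by simp
  qed
  have "\<exists>s. \<bar>\<delta> b\<bar> = s * \<delta> b \<and> \<bar>s\<bar> = 1" by (cases "\<delta> b \<ge> 0") (auto intro: exI[of _ 1] exI[of _ "-1"])
  then obtain s where "\<forall>a<?N. \<bar>\<delta> a\<bar> = s * \<delta> a" using sign by blast
  then have "(\<Sum>a<?N. \<bar>\<delta> a\<bar>) = s * (\<Sum>a<?N. \<delta> a)" by (simp add: sum_distrib_left)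
  then have "\<forall>a<?N. \<delta> a = 0" using sum0 by (simp add: sum_nonneg_eq_0_iff)
  then show ?thesis using car by (intro eq_vecI) (auto simp: \<delta>_def)
qed

end

section \<open>Partition sums and fixed linear orders\<close>


text \<open>This is the exponential of a set function: if \<open>f b\<close> counts connected
  structures on \<open>b\<close>, the sum counts all structures on \<open>A\<close> assembled from
  them. Permutations are assembled from cycles in this way.\<close>

definition partition_sum :: "('a set \<Rightarrow> nat) \<Rightarrow> 'a set \<Rightarrow> nat" where
  "partition_sum f A = (\<Sum>\<beta> | partition_on A \<beta>. \<Prod>b\<in>\<beta>. f b)"

lemma partition_sum_empty:
  fixes f :: "'a set \<Rightarrow> nat"
  shows "partition_sum f {} = 1"
proof -
  have "{\<beta> :: 'a set set. partition_on {} \<beta>} = {{}}" by (auto simp: partition_on_empty)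
  then show ?thesis by (simp only: partition_sum_def) simp
qed

lemma partition_sum_cong:
  assumes "\<And>b. b \<subseteq> A \<Longrightarrow> b \<noteq> {} \<Longrightarrow> f b = g b"
  shows "partition_sum f A = partition_sum g A"
  unfolding partition_sum_def
proof (rule sum.cong[OF refl], rule prod.cong[OF refl])
  fix \<beta> b assume "\<beta> \<in> {\<beta>. partition_on A \<beta>}" "b \<in> \<beta>"
  then show "f b = g b" by (intro assms) (auto simp: partition_on_def)
qed

text \<open>A partition with a block meeting both sides contributes zero. Every other partition is a
  partition of \<open>A\<close> together with one of \<open>B\<close>, and its product splits
  accordingly.\<close>

lemma partition_sum_Un:
  assumes fin: "finite A" "finite B" and disj: "A \<inter> B = {}"
    and f: "\<And>b. b \<inter> A \<noteq> {} \<Longrightarrow> b \<inter> B \<noteq> {} \<Longrightarrow> f b = 0"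
  shows "partition_sum f (A \<union> B) = partition_sum f A * partition_sum f B"
proof -
  let ?P = "\<lambda>A. {\<beta>. partition_on A \<beta>}"
  let ?S = "{\<beta>. partition_on (A \<union> B) \<beta> \<and> (\<forall>b\<in>\<beta>. b \<subseteq> A \<or> b \<subseteq> B)}"
  have "partition_sum f (A \<union> B) = (\<Sum>\<beta>\<in>?S. \<Prod>b\<in>\<beta>. f b)"
    unfolding partition_sum_def
  proof (rule sum.mono_neutral_right)
    show "finite (?P (A \<union> B))" using fin by (intro finitely_many_partition_on) auto
    show "\<forall>\<beta>\<in>?P (A \<union> B) - ?S. (\<Prod>b\<in>\<beta>. f b) = 0"
    proof
      fix \<beta> assume \<beta>: "\<beta> \<in> ?P (A \<union> B) - ?S"
      then obtain b where b: "b \<in> \<beta>" "\<not> b \<subseteq> A" "\<not> b \<subseteq> B" by auto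
      moreover have "b \<subseteq> A \<union> B" using \<beta> b by (auto simp: partition_on_def)
      ultimately have "f b = 0" by (intro f) auto
      moreover have "finite \<beta>" using \<beta> fin finite_elements[of "A \<union> B" \<beta>] by auto
      ultimately show "(\<Prod>b\<in>\<beta>. f b) = 0" using b(1) by auto
    qed
  qed auto
  also have "\<dots> = (\<Sum>(\<beta>, \<gamma>)\<in>?P A \<times> ?P B. (\<Prod>b\<in>\<beta>. f b) * (\<Prod>b\<in>\<gamma>. f b))"
  proof (rule sum.reindex_bij_witness[where i = "\<lambda>(\<beta>, \<gamma>). \<beta> \<union> \<gamma>"
        and j = "\<lambda>\<beta>. ({b \<in> \<beta>. b \<subseteq> A}, {b \<in> \<beta>. b \<subseteq> B})"])
    fix \<beta> assume \<beta>: "\<beta> \<in> ?S"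
    then have part: "disjoint \<beta>" "{} \<notin> \<beta>" "\<Union>\<beta> = A \<union> B" and sub: "\<forall>b\<in>\<beta>. b \<subseteq> A \<or> b \<subseteq> B"
      by (auto simp: partition_on_def)
    show un: "(case ({b \<in> \<beta>. b \<subseteq> A}, {b \<in> \<beta>. b \<subseteq> B}) of (\<beta>, \<gamma>) \<Rightarrow> \<beta> \<union> \<gamma>) = \<beta>"
      using sub by auto
    have "\<exists>b\<in>\<beta>. x \<in> b \<and> b \<subseteq> A" if "x \<in> A" for x
    proof -
      have "x \<in> \<Union>\<beta>" using part(3) that by auto
      then obtain b where "b \<in> \<beta>" "x \<in> b" by auto
      then show ?thesis using sub disj that by (intro bexI[of _ b]) auto
    qed
    moreover have "\<exists>b\<in>\<beta>. x \<in> b \<and> b \<subseteq> B" if "x \<in> B" for x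
    proof -
      have "x \<in> \<Union>\<beta>" using part(3) that by auto
      then obtain b where "b \<in> \<beta>" "x \<in> b" by auto
      then show ?thesis using sub disj that by (intro bexI[of _ b]) auto
    qed
    ultimately have "\<Union>{b \<in> \<beta>. b \<subseteq> A} = A" "\<Union>{b \<in> \<beta>. b \<subseteq> B} = B" by blast+
    then show "({b \<in> \<beta>. b \<subseteq> A}, {b \<in> \<beta>. b \<subseteq> B}) \<in> ?P A \<times> ?P B"
      using part(1,2) by (auto simp: partition_on_def disjoint_def)
    have fin\<beta>: "finite \<beta>" using \<beta> fin finite_elements[of "A \<union> B" \<beta>] by auto
    have "(\<Prod>b\<in>{b \<in> \<beta>. b \<subseteq> A} \<union> {b \<in> \<beta>. b \<subseteq> B}. f b) =
        (\<Prod>b\<in>{b \<in> \<beta>. b \<subseteq> A}. f b) * (\<Prod>b\<in>{b \<in> \<beta>. b \<subseteq> B}. f b)"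
    proof (rule prod.union_disjoint)
      show "{b \<in> \<beta>. b \<subseteq> A} \<inter> {b \<in> \<beta>. b \<subseteq> B} = {}"
      proof (rule equals0I)
        fix b assume "b \<in> {b \<in> \<beta>. b \<subseteq> A} \<inter> {b \<in> \<beta>. b \<subseteq> B}"
        then have "b \<in> \<beta>" "b \<subseteq> A \<inter> B" by auto
        then show False using disj part(2) by auto
      qed
    qed (use fin\<beta> in auto)
    then show "(case ({b \<in> \<beta>. b \<subseteq> A}, {b \<in> \<beta>. b \<subseteq> B}) of
        (\<beta>, \<gamma>) \<Rightarrow> (\<Prod>b\<in>\<beta>. f b) * (\<Prod>b\<in>\<gamma>. f b)) = (\<Prod>b\<in>\<beta>. f b)"
      using un by simp
  next
    fix p assume "p \<in> ?P A \<times> ?P B"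
    then obtain \<beta> \<gamma> where p: "p = (\<beta>, \<gamma>)" and \<beta>: "partition_on A \<beta>" and \<gamma>: "partition_on B \<gamma>"
      by auto
    have \<beta>A: "b \<subseteq> A \<and> b \<noteq> {}" if "b \<in> \<beta>" for b using that \<beta> by (auto simp: partition_on_def)
    have \<gamma>B: "b \<subseteq> B \<and> b \<noteq> {}" if "b \<in> \<gamma>" for b using that \<gamma> by (auto simp: partition_on_def)
    have 1: "{b \<in> \<beta> \<union> \<gamma>. b \<subseteq> A} = \<beta>" using \<beta>A \<gamma>B disj by blast
    have 2: "{b \<in> \<beta> \<union> \<gamma>. b \<subseteq> B} = \<gamma>" using \<beta>A \<gamma>B disj by blast
    show "({b \<in> (case p of (\<beta>, \<gamma>) \<Rightarrow> \<beta> \<union> \<gamma>). b \<subseteq> A},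
        {b \<in> (case p of (\<beta>, \<gamma>) \<Rightarrow> \<beta> \<union> \<gamma>). b \<subseteq> B}) = p"
      unfolding p using 1 2 by simp
    have "partition_on (A \<union> B) (\<beta> \<union> \<gamma>)"
      using \<beta> \<gamma> disj unfolding partition_on_def by (auto intro!: disjoint_union)
    then show "(case p of (\<beta>, \<gamma>) \<Rightarrow> \<beta> \<union> \<gamma>) \<in> ?S"
      unfolding p using \<beta>A \<gamma>B by auto
  qed
  also have "\<dots> = partition_sum f A * partition_sum f B"
    unfolding partition_sum_def sum_product sum.cartesian_product ..
  finally show ?thesis .
qed

lemma partition_sum_Union:
  assumes "finite \<pi>" "\<And>B. B \<in> \<pi> \<Longrightarrow> finite B" "disjoint \<pi>"
    and "\<And>b B C. B \<in> \<pi> \<Longrightarrow> C \<in> \<pi> \<Longrightarrow> B \<noteq> C \<Longrightarrow> b \<inter> B \<noteq> {} \<Longrightarrow> b \<inter> C \<noteq> {} \<Longrightarrow> f b = 0"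
  shows "partition_sum f (\<Union>\<pi>) = (\<Prod>B\<in>\<pi>. partition_sum f B)"
  using assms
proof (induction \<pi> rule: finite_induct)
  case empty
  then show ?case by (simp add: partition_sum_empty)
next
  case (insert B \<pi>)
  have "partition_sum f (B \<union> \<Union>\<pi>) = partition_sum f B * partition_sum f (\<Union>\<pi>)"
  proof (rule partition_sum_Un)
    show "B \<inter> \<Union>\<pi> = {}" using insert.prems(2) insert.hyps by (auto simp: disjoint_def)
    show "finite B" "finite (\<Union>\<pi>)" using insert.prems(1) insert.hyps by auto
    fix b assume "b \<inter> B \<noteq> {}" "b \<inter> \<Union>\<pi> \<noteq> {}"
    then obtain C where "C \<in> \<pi>" "b \<inter> C \<noteq> {}" by auto
    moreover from this have "B \<noteq> C" using insert.hyps by auto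
    ultimately show "f b = 0" using insert.prems(3)[of B C b] \<open>b \<inter> B \<noteq> {}\<close> by simp
  qed
  moreover have "partition_sum f (\<Union>\<pi>) = (\<Prod>B\<in>\<pi>. partition_sum f B)"
  proof (rule insert.IH)
    show "disjoint \<pi>" using insert.prems(2) by (auto simp: disjoint_def)
    show "f b = 0" if "C \<in> \<pi>" "D \<in> \<pi>" "C \<noteq> D" "b \<inter> C \<noteq> {}" "b \<inter> D \<noteq> {}" for b C D
      using insert.prems(3)[OF _ _ that(3-5)] that(1,2) by simp
  qed (use insert.prems in auto)
  ultimately show ?case using insert.hyps by simp
qed

text \<open>Partitions are sorted by the block that contains \<open>x\<close>; here \<open>b\<close>
  is that block without \<open>x\<close>. As the only block containing \<open>x\<close>, it can be
  recovered from the partition.\<close>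

lemma partition_sum_insert:
  assumes fin: "finite A" and x: "x \<notin> A"
  shows "partition_sum f (insert x A) = (\<Sum>b\<in>Pow A. f (insert x b) * partition_sum f (A - b))"
proof -
  let ?P = "\<lambda>A. {\<beta>. partition_on A \<beta>}"
  let ?h = "\<lambda>(b, \<gamma>). insert (insert x b) \<gamma>"
  let ?S = "SIGMA b:Pow A. ?P (A - b)"
  have x\<gamma>: "x \<notin> c" if "partition_on (A - b) \<gamma>" "c \<in> \<gamma>" for b \<gamma> c
    using that x by (auto simp: partition_on_def)
  have ins: "partition_on (insert x A) (insert (insert x b) \<gamma>) \<longleftrightarrow> partition_on (A - b) \<gamma>"
    if "b \<subseteq> A" "disjnt (insert x b) (\<Union>\<gamma>)" for b \<gamma>
  proof -
    have "insert x A - insert x b = A - b" using x by auto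
    then show ?thesis using partition_on_insert[OF that(2), of "insert x A"] that(1) by auto
  qed
  have inj: "inj_on ?h ?S"
  proof (rule inj_onI, clarify)
    fix b \<gamma> b' \<gamma>'
    assume *: "b \<subseteq> A" "b' \<subseteq> A" "partition_on (A - b) \<gamma>" "partition_on (A - b') \<gamma>'"
      "insert (insert x b) \<gamma> = insert (insert x b') \<gamma>'"
    have "{c \<in> insert (insert x b) \<gamma>. x \<in> c} = {insert x b}" using x\<gamma>[OF *(3)] by auto
    moreover have "{c \<in> insert (insert x b') \<gamma>'. x \<in> c} = {insert x b'}" using x\<gamma>[OF *(4)] by auto
    ultimately have "insert x b = insert x b'" using *(5) by simp
    then have b: "b = b'" using *(1,2) x insert_ident[of x b b'] by auto
    have "\<gamma> = {c \<in> insert (insert x b) \<gamma>. x \<notin> c}" using x\<gamma>[OF *(3)] by auto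
    also have "\<dots> = \<gamma>'" unfolding *(5) using x\<gamma>[OF *(4)] by auto
    finally show "b = b' \<and> \<gamma> = \<gamma>'" using b by simp
  qed
  have img: "?h ` ?S = ?P (insert x A)"
  proof (intro equalityI subsetI)
    fix \<beta> assume "\<beta> \<in> ?h ` ?S"
    then obtain b \<gamma> where *: "b \<subseteq> A" "partition_on (A - b) \<gamma>" "\<beta> = insert (insert x b) \<gamma>" by auto
    have "disjnt (insert x b) (\<Union>\<gamma>)" using *(2) x by (auto simp: partition_on_def disjnt_def)
    then show "\<beta> \<in> ?P (insert x A)" using ins * by simp
  next
    fix \<beta> assume "\<beta> \<in> ?P (insert x A)"
    then have \<beta>: "partition_on (insert x A) \<beta>" by simp
    then obtain c where c: "c \<in> \<beta>" "x \<in> c" by (auto simp: partition_on_def)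
    define b where "b = c - {x}"
    have b: "b \<subseteq> A" "insert x b = c" using c \<beta> by (auto simp: b_def partition_on_def)
    have eq: "\<beta> = insert (insert x b) (\<beta> - {c})" using b c by auto
    have "c \<inter> d = {}" if "d \<in> \<beta> - {c}" for d
      using disjointD[OF partition_onD2[OF \<beta>] c(1), of d] that by auto
    then have "disjnt (insert x b) (\<Union>(\<beta> - {c}))"
      unfolding b(2) by (auto simp: disjnt_def)
    from ins[OF b(1) this] have "partition_on (A - b) (\<beta> - {c})" using eq \<beta> by simp
    then have "(b, \<beta> - {c}) \<in> ?S" using b by simp
    moreover have "?h (b, \<beta> - {c}) = \<beta>" using eq by simp
    ultimately show "\<beta> \<in> ?h ` ?S" by (intro image_eqI[of _ _ "(b, \<beta> - {c})"]) auto
  qed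
  have "partition_sum f (insert x A) = (\<Sum>(b, \<gamma>)\<in>?S. f (insert x b) * (\<Prod>c\<in>\<gamma>. f c))"
    unfolding partition_sum_def
  proof (rule sum.reindex_cong[OF inj img[symmetric]])
    fix p assume "p \<in> ?S"
    then obtain b \<gamma> where p: "p = (b, \<gamma>)" "partition_on (A - b) \<gamma>" by auto
    have "insert x b \<notin> \<gamma>" using x\<gamma>[OF p(2)] by auto
    moreover have "finite \<gamma>" using finite_elements[OF _ p(2)] fin by auto
    ultimately show "prod f (?h p) = (case p of (b, \<gamma>) \<Rightarrow> f (insert x b) * (\<Prod>c\<in>\<gamma>. f c))"
      using p by simp
  qed
  also have "\<dots> = (\<Sum>b\<in>Pow A. \<Sum>\<gamma>\<in>?P (A - b). f (insert x b) * (\<Prod>c\<in>\<gamma>. f c))"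
    using fin by (intro sum.Sigma[symmetric]) (auto intro: finitely_many_partition_on)
  finally show ?thesis by (simp add: partition_sum_def sum_distrib_left)
qed

text \<open>Both sides count the permutations of \<open>A\<close>: the factor \<open>fact (card b - 1)\<close> is the number of
  cyclic permutations of \<open>b\<close>.\<close>

lemma partition_sum_fact:
  assumes "finite A"
  shows "partition_sum (\<lambda>b. fact (card b - 1)) A = fact (card A)"
  using assms
proof (induction "card A" arbitrary: A rule: less_induct)
  case less
  show ?case
  proof (cases "A = {}")
    case True
    then show ?thesis by (simp add: partition_sum_empty)
  next
    case False
    then obtain x S where A: "A = insert x S" "x \<notin> S" by (meson Set.set_insert ex_in_conv)
    have finS: "finite S" using less.prems A by simp
    let ?m = "card S"
    have "partition_sum (\<lambda>b. fact (card b - 1)) A =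
        (\<Sum>b\<in>Pow S. fact (card b) * fact (?m - card b))"
      unfolding A(1) partition_sum_insert[OF finS A(2)]
    proof (rule sum.cong[OF refl])
      fix b assume b: "b \<in> Pow S"
      then have fb: "finite b" "x \<notin> b" using finS A by (auto intro: finite_subset)
      have "card (S - b) < card A" using A finS by (simp add: card_mono le_imp_less_Suc)
      then have "partition_sum (\<lambda>b. fact (card b - 1)) (S - b) = fact (card (S - b))"
        using less.hyps[of "S - b"] finS by simp
      then show "fact (card (insert x b) - 1) * partition_sum (\<lambda>b. fact (card b - 1)) (S - b) =
          fact (card b) * fact (?m - card b)"
        using b fb by (simp add: card_Diff_subset)
    qed
    \<comment> \<open>With m = \<open>?m\<close> there are (m choose k) blocks having k elements
      besides \<open>x\<close>, each contributing k! (m - k)!. So every k contributes m!, and the m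
      + 1 values of k add up to (m + 1)!.\<close>
    also have "\<dots> = (\<Sum>k\<le>?m. \<Sum>b | b \<in> Pow S \<and> card b = k. fact (card b) * fact (?m - card b))"
      using finS by (intro sum.group[symmetric]) (auto intro: card_mono)
    also have "\<dots> = (\<Sum>k\<le>?m. fact ?m)"
    proof (rule sum.cong[OF refl])
      fix k assume k: "k \<in> {..?m}"
      have "(\<Sum>b | b \<in> Pow S \<and> card b = k. fact (card b) * fact (?m - card b)) =
          (?m choose k) * (fact k * fact (?m - k))"
        using n_subsets[OF finS, of k] by simp
      also have "\<dots> = fact ?m" using binomial_fact_lemma[of k ?m] k by (simp add: mult_ac)
      finally show "(\<Sum>b | b \<in> Pow S \<and> card b = k. fact (card b) * fact (?m - card b)) = (fact ?m :: nat)" .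
    qed
    also have "\<dots> = fact (card A)" using A finS by simp
    finally show ?thesis .
  qed
qed

section \<open>Linear orders fixed by words of move-to-front steps\<close>

text \<open>Polymorphic because it serves at both levels, for the books on a shelf and for the
  shelves or blocks in a configuration.\<close>

definition move_front :: "'a set \<Rightarrow> 'a list \<Rightarrow> 'a list" where
  "move_front E xs = filter (\<lambda>x. x \<in> E) xs @ filter (\<lambda>x. x \<notin> E) xs"

lemma set_move_front [simp]: "set (move_front E xs) = set xs"
  by (auto simp: move_front_def)

lemma distinct_move_front [simp]: "distinct (move_front E xs) = distinct xs"
  by (induction xs) (auto simp: move_front_def)

lemma filter_move_front: "filter Q (move_front E xs) = move_front E (filter Q xs)"
  by (simp add: move_front_def conj_commute)

lemma move_front_idem: "move_front E (move_front E xs) = move_front E xs"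
  by (simp add: move_front_def)

text \<open>\<open>move_front E\<close> is a stable sort by membership in \<open>E\<close>. After
  sorting by \<open>F\<close> and then by \<open>E\<close>, the earlier order only decides between
  elements that agree on both, and a still earlier sort by \<open>E\<close> does not affect
  those.\<close>

lemma move_front_left_regular:
  "move_front E (move_front F (move_front E xs)) = move_front E (move_front F xs)"
  by (simp add: move_front_def conj_ac)

lemma set_foldr_move_front [simp]: "set (foldr move_front Es xs) = set xs"
  by (induction Es) auto

lemma foldr_move_front_Nil [simp]: "foldr move_front Es [] = []"
  by (induction Es) (auto simp: move_front_def)

lemma filter_foldr_move_front:
  "filter Q (foldr move_front Es xs) = foldr move_front Es (filter Q xs)"
  by (induction Es) (auto simp: filter_move_front)

text \<open>A nonempty \<open>b\<close> satisfies this exactly when it lies inside a single atom of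
  the Boolean algebra generated by the letters.\<close>

definition unsplit :: "'a set list \<Rightarrow> 'a set \<Rightarrow> bool" where
  "unsplit Es b \<longleftrightarrow> (\<forall>E\<in>set Es. b \<subseteq> E \<or> b \<inter> E = {})"

text \<open>The letter \<open>E\<close> acts last, so a fixed order lists
  \<open>A \<inter> E\<close> before \<open>A - E\<close>, and each of the two parts must be fixed
  by the remaining word. The partition sum factors in the same way, since a block straddling
  \<open>E\<close> has weight 0. For the empty word every order is fixed.\<close>

lemma card_fixed_orders:
  assumes "finite A"
  shows "card {xs \<in> permutations_of_set A. foldr move_front Es xs = xs} =
    partition_sum (\<lambda>b. if unsplit Es b then fact (card b - 1) else 0) A"
  using assms
proof (induction Es arbitrary: A)
  case Nil
  then show ?case using partition_sum_fact[OF Nil] by (simp add: unsplit_def)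
next
  case (Cons E Es)
  let ?X = "\<lambda>Es A. {xs \<in> permutations_of_set A. foldr move_front Es xs = xs}"
  let ?f = "\<lambda>Es b. if unsplit Es b then fact (card b - 1) else (0 :: nat)"
  let ?h = "\<lambda>(ys, zs). ys @ zs"
  have split: "move_front E (foldr move_front Es (ys @ zs)) =
      foldr move_front Es ys @ foldr move_front Es zs" if "set ys \<subseteq> E" "set zs \<inter> E = {}" for ys zs
  proof -
    have "filter (\<lambda>x. x \<in> E) ys = ys" "filter (\<lambda>x. x \<in> E) zs = []"
      "filter (\<lambda>x. x \<notin> E) ys = []" "filter (\<lambda>x. x \<notin> E) zs = zs"
      using that by (auto simp: filter_id_conv filter_empty_conv)
    then show ?thesis by (simp add: move_front_def filter_foldr_move_front)
  qed
  have inj: "inj_on ?h (?X Es (A \<inter> E) \<times> ?X Es (A - E))"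
  proof (rule inj_onI, clarify)
    fix ys zs ys' zs'
    assume *: "ys \<in> permutations_of_set (A \<inter> E)" "ys' \<in> permutations_of_set (A \<inter> E)"
      and eq: "ys @ zs = ys' @ zs'"
    have "length ys = length ys'" using * by (metis length_finite_permutations_of_set)
    then show "ys = ys' \<and> zs = zs'" using eq by simp
  qed
  have img: "?h ` (?X Es (A \<inter> E) \<times> ?X Es (A - E)) = ?X (E # Es) A"
  proof (intro equalityI subsetI)
    fix xs assume "xs \<in> ?h ` (?X Es (A \<inter> E) \<times> ?X Es (A - E))"
    then obtain ys zs where *: "xs = ys @ zs" "set ys = A \<inter> E" "set zs = A - E" "distinct ys"
      "distinct zs" "foldr move_front Es ys = ys" "foldr move_front Es zs = zs"
      by (auto simp: permutations_of_set_def)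
    then show "xs \<in> ?X (E # Es) A"
      using split[of ys zs] by (auto simp: permutations_of_set_def)
  next
    fix xs assume "xs \<in> ?X (E # Es) A"
    then have xs: "set xs = A" "distinct xs" "move_front E (foldr move_front Es xs) = xs"
      by (auto simp: permutations_of_set_def)
    define ys zs where "ys = filter (\<lambda>x. x \<in> E) xs" and "zs = filter (\<lambda>x. x \<notin> E) xs"
    have "foldr move_front Es ys @ foldr move_front Es zs = xs"
      using xs(3) by (simp add: move_front_def filter_foldr_move_front ys_def zs_def)
    moreover from this have "filter (\<lambda>x. x \<in> E) (foldr move_front Es ys @ foldr move_front Es zs) = ys"
      by (simp add: ys_def)
    then have "foldr move_front Es ys = ys"
      by (simp add: filter_foldr_move_front) (simp add: ys_def zs_def)
    moreover have "filter (\<lambda>x. x \<notin> E) (foldr move_front Es ys @ foldr move_front Es zs) = zs"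
      using calculation(1) by (simp add: zs_def)
    then have "foldr move_front Es zs = zs"
      by (simp add: filter_foldr_move_front) (simp add: ys_def zs_def)
    ultimately have "xs = ys @ zs" "foldr move_front Es ys = ys" "foldr move_front Es zs = zs"
      by simp_all
    moreover have "ys \<in> permutations_of_set (A \<inter> E)" "zs \<in> permutations_of_set (A - E)"
      using xs by (auto simp: permutations_of_set_def ys_def zs_def)
    ultimately show "xs \<in> ?h ` (?X Es (A \<inter> E) \<times> ?X Es (A - E))" by auto
  qed
  have "card (?X (E # Es) A) = card (?X Es (A \<inter> E) \<times> ?X Es (A - E))"
    using card_image[OF inj] unfolding img by simp
  also have "\<dots> = partition_sum (?f Es) (A \<inter> E) * partition_sum (?f Es) (A - E)"
    using Cons.IH[of "A \<inter> E"] Cons.IH[of "A - E"] Cons.prems by (simp add: card_cartesian_product)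
  \<comment> \<open>Inside \<open>A \<inter> E\<close>, and likewise inside \<open>A - E\<close>,
    the additional letter \<open>E\<close> splits no block.\<close>
  also have "partition_sum (?f Es) (A \<inter> E) = partition_sum (?f (E # Es)) (A \<inter> E)"
    by (rule partition_sum_cong) (auto simp: unsplit_def)
  also have "partition_sum (?f Es) (A - E) = partition_sum (?f (E # Es)) (A - E)"
    by (rule partition_sum_cong) (auto simp: unsplit_def)
  also have "partition_sum (?f (E # Es)) (A \<inter> E) * partition_sum (?f (E # Es)) (A - E) =
      partition_sum (?f (E # Es)) ((A \<inter> E) \<union> (A - E))"
    using Cons.prems by (intro partition_sum_Un[symmetric]) (auto simp: unsplit_def)
  also have "(A \<inter> E) \<union> (A - E) = A" by auto
  finally show ?case .
qed

section \<open>Fixed configurations of words of library steps\<close>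


lemma map_move_front: "map f (move_front (f -` F) xs) = move_front F (map f xs)"
  by (simp add: move_front_def filter_map comp_def)

lemma map_foldr_move_front:
  "map f (foldr move_front (map ((-`) f) Fs) xs) = foldr move_front Fs (map f xs)"
  by (induction Fs) (simp_all add: map_move_front)

text \<open>The front shelves as a set of blocks instead of a set of books, so that the shelf move
  becomes \<open>move_front\<close> on the list of blocks. Subsets of \<open>K_set \<pi> E\<close>
  that are not blocks also belong to it, which is harmless on lists of blocks.\<close>

definition front_blocks :: "nat set set \<Rightarrow> nat set \<Rightarrow> nat set set" where
  "front_blocks \<pi> E = {B. B \<subseteq> K_set \<pi> E}"

lemma shelf_step_eq: "shelf_step E = move_front E"
  by (simp add: fun_eq_iff shelf_step_def move_front_def)

lemma library_step_eq:
  "library_step \<pi> E c = map (move_front E) (move_front (set -` front_blocks \<pi> E) c)"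
  by (simp add: library_step_def shelf_step_eq move_front_def front_blocks_def)

text \<open>Whether a shelf moves depends only on its set of books, which rearranging the books does
  not change. Hence all shelf moves of a word can be carried out before all book moves.\<close>

lemma foldr_library_step:
  "foldr (library_step \<pi>) Es c =
     map (foldr move_front Es) (foldr move_front (map (\<lambda>E. set -` front_blocks \<pi> E) Es) c)"
proof (induction Es)
  case (Cons E Es)
  have "foldr move_front Es -` (set -` front_blocks \<pi> E) = set -` front_blocks \<pi> E"
    by auto
  then have "move_front (set -` front_blocks \<pi> E) (map (foldr move_front Es) d) =
      map (foldr move_front Es) (move_front (set -` front_blocks \<pi> E) d)" for d
    using map_move_front[of "foldr move_front Es" "set -` front_blocks \<pi> E" d] by simp
  then show ?case by (simp add: Cons library_step_eq[of \<pi> E])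
qed simp

lemma library_step_idem: "library_step \<pi> E (library_step \<pi> E c) = library_step \<pi> E c"
  using foldr_library_step[of \<pi> "[E, E]" c] foldr_library_step[of \<pi> "[E]" c]
  by (simp add: move_front_idem comp_def)

lemma library_step_left_regular:
  "library_step \<pi> E (library_step \<pi> F (library_step \<pi> E c)) =
     library_step \<pi> E (library_step \<pi> F c)"
  using foldr_library_step[of \<pi> "[E, F, E]" c] foldr_library_step[of \<pi> "[E, F]" c]
  by (simp add: move_front_left_regular comp_def)

lemma map_set_foldr_library_step:
  "map set (foldr (library_step \<pi>) Es c) =
     foldr move_front (map (front_blocks \<pi>) Es) (map set c)"
proof -
  have "map set (foldr (library_step \<pi>) Es c) =
      map set (foldr move_front (map ((-`) set) (map (front_blocks \<pi>) Es)) c)"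
    by (simp add: foldr_library_step comp_def)
  then show ?thesis by (simp only: map_foldr_move_front)
qed

lemma library_step_closed:
  assumes "c \<in> library_configs \<pi>"
  shows "library_step \<pi> E c \<in> library_configs \<pi>"
proof -
  have "map set (library_step \<pi> E c) = move_front (front_blocks \<pi> E) (map set c)"
    using map_set_foldr_library_step[of \<pi> "[E]" c] by simp
  moreover have "\<forall>sh\<in>set (library_step \<pi> E c). distinct sh"
    using assms by (auto simp: library_step_eq library_configs_def)
  ultimately show ?thesis
    using assms by (simp add: library_configs_def del: set_map)
qed

text \<open>Distinct shelves hold distinct sets, so the list of blocks determines the order of the
  shelves. Once that order is preserved, each shelf is compared with itself.\<close>

lemma library_step_fixed_iff:
  assumes c: "c \<in> library_configs \<pi>"
  shows "foldr (library_step \<pi>) Es c = c \<longleftrightarrow>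
    foldr move_front (map (front_blocks \<pi>) Es) (map set c) = map set c \<and>
    (\<forall>sh\<in>set c. foldr move_front Es sh = sh)"
proof -
  let ?d = "foldr move_front (map (\<lambda>E. set -` front_blocks \<pi> E) Es) c"
  have setd: "set ?d = set c" by simp
  have inj: "inj_on set (set c)" using c by (simp add: library_configs_def distinct_map)
  have "map set ?d = foldr move_front (map (front_blocks \<pi>) Es) (map set c)"
    using map_foldr_move_front[of set "map (front_blocks \<pi>) Es" c] by (simp add: comp_def)
  then have d: "foldr move_front (map (front_blocks \<pi>) Es) (map set c) = map set c \<longleftrightarrow> ?d = c"
    using inj_on_map_eq_map[of set ?d c] inj setd by simp
  show ?thesis
  proof
    assume fixed: "foldr (library_step \<pi>) Es c = c"
    then have dc: "?d = c" using map_set_foldr_library_step[of \<pi> Es c] d by simp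
    have "map (foldr move_front Es) c = map (\<lambda>x. x) c"
      using fixed unfolding foldr_library_step dc by simp
    then have "\<forall>sh\<in>set c. foldr move_front Es sh = sh" by (simp only: map_eq_conv)
    then show "foldr move_front (map (front_blocks \<pi>) Es) (map set c) = map set c \<and>
        (\<forall>sh\<in>set c. foldr move_front Es sh = sh)"
      using d dc by blast
  next
    assume "foldr move_front (map (front_blocks \<pi>) Es) (map set c) = map set c \<and>
        (\<forall>sh\<in>set c. foldr move_front Es sh = sh)"
    then have dc: "?d = c" and id: "\<And>sh. sh \<in> set c \<Longrightarrow> foldr move_front Es sh = sh"
      using d by blast+
    show "foldr (library_step \<pi>) Es c = c"
      unfolding foldr_library_step dc by (rule map_idI) (rule id)
  qed
qed

lemma card_lists_with_map:
  "card {c. map f c = \<sigma> \<and> (\<forall>s\<in>set c. Q s)} = (\<Prod>y\<leftarrow>\<sigma>. card {s. f s = y \<and> Q s})"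
proof (induction \<sigma>)
  case (Cons y \<sigma>)
  have "{c. map f c = y # \<sigma> \<and> (\<forall>s\<in>set c. Q s)} =
      (\<lambda>(s, c). s # c) ` ({s. f s = y \<and> Q s} \<times> {c. map f c = \<sigma> \<and> (\<forall>s\<in>set c. Q s)})"
  proof (intro equalityI subsetI)
    fix c assume "c \<in> {c. map f c = y # \<sigma> \<and> (\<forall>s\<in>set c. Q s)}"
    then obtain s c' where "c = s # c'" "f s = y" "map f c' = \<sigma>" "Q s" "\<forall>s\<in>set c'. Q s"
      by (cases c) auto
    then show "c \<in> (\<lambda>(s, c). s # c) `
        ({s. f s = y \<and> Q s} \<times> {c. map f c = \<sigma> \<and> (\<forall>s\<in>set c. Q s)})"
      by (intro image_eqI[of _ _ "(s, c')"]) auto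
  qed auto
  moreover have "inj_on (\<lambda>(s, c). s # c) X" for X :: "('a \<times> 'a list) set"
    by (auto simp: inj_on_def)
  ultimately show ?case using Cons by (simp add: card_image card_cartesian_product)
next
  case Nil
  have "{c. map f c = [] \<and> (\<forall>s\<in>set c. Q s)} = {[]}" by auto
  then show ?case by simp
qed

text \<open>Fixed configurations are grouped by the order \<sigma> of their blocks. The number of
  ways to order the books is a product over all blocks, hence the same for every \<sigma>.\<close>

lemma card_fixed_configs:
  assumes fin: "finite (library_configs \<pi>)" "finite \<pi>"
  shows "card {c \<in> library_configs \<pi>. foldr (library_step \<pi>) Es c = c} =
    card {\<sigma> \<in> permutations_of_set \<pi>. foldr move_front (map (front_blocks \<pi>) Es) \<sigma> = \<sigma>} *
    (\<Prod>B\<in>\<pi>. card {sh \<in> permutations_of_set B. foldr move_front Es sh = sh})"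
proof -
  let ?X = "{\<sigma> \<in> permutations_of_set \<pi>. foldr move_front (map (front_blocks \<pi>) Es) \<sigma> = \<sigma>}"
  let ?Q = "\<lambda>sh :: nat list. distinct sh \<and> foldr move_front Es sh = sh"
  let ?Z = "\<lambda>\<sigma>. {c. map set c = \<sigma> \<and> (\<forall>sh\<in>set c. ?Q sh)}"
  have "{c \<in> library_configs \<pi>. foldr (library_step \<pi>) Es c = c} = (\<Union>\<sigma>\<in>?X. ?Z \<sigma>)"
  proof (intro equalityI subsetI)
    fix c assume "c \<in> {c \<in> library_configs \<pi>. foldr (library_step \<pi>) Es c = c}"
    then have c: "c \<in> library_configs \<pi>" "foldr (library_step \<pi>) Es c = c" by auto
    then have "map set c \<in> ?X" "c \<in> ?Z (map set c)"
      using library_step_fixed_iff[OF c(1), of Es]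
      by (auto simp: library_configs_def permutations_of_set_def)
    then show "c \<in> (\<Union>\<sigma>\<in>?X. ?Z \<sigma>)" by blast
  next
    fix c assume "c \<in> (\<Union>\<sigma>\<in>?X. ?Z \<sigma>)"
    then have X: "map set c \<in> ?X" and Q: "\<forall>sh\<in>set c. ?Q sh" by auto
    then have "c \<in> library_configs \<pi>" by (simp add: library_configs_def permutations_of_set_def)
    then show "c \<in> {c \<in> library_configs \<pi>. foldr (library_step \<pi>) Es c = c}"
      using library_step_fixed_iff[of c \<pi> Es] X Q by simp
  qed
  moreover have "card (\<Union>\<sigma>\<in>?X. ?Z \<sigma>) = (\<Sum>\<sigma>\<in>?X. card (?Z \<sigma>))"
  proof (rule card_UN_disjoint)
    show "finite ?X" using fin(2) by simp
    show "\<forall>\<sigma>\<in>?X. finite (?Z \<sigma>)"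
      by (auto intro!: finite_subset[OF _ fin(1)] simp: library_configs_def permutations_of_set_def)
  qed auto
  moreover have "card (?Z \<sigma>) = (\<Prod>B\<in>\<pi>. card {sh \<in> permutations_of_set B. foldr move_front Es sh = sh})"
    if "\<sigma> \<in> ?X" for \<sigma>
  proof -
    have \<sigma>: "distinct \<sigma>" "set \<sigma> = \<pi>" using that by (auto simp: permutations_of_set_def)
    have "card (?Z \<sigma>) = (\<Prod>B\<leftarrow>\<sigma>. card {sh. set sh = B \<and> ?Q sh})" by (rule card_lists_with_map)
    also have "\<dots> = (\<Prod>B\<in>\<pi>. card {sh. set sh = B \<and> ?Q sh})"
      using prod.distinct_set_conv_list[OF \<sigma>(1), of "\<lambda>B. card {sh. set sh = B \<and> ?Q sh}"] \<sigma>(2)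
      by simp
    finally show ?thesis by (simp add: permutations_of_set_def)
  qed
  ultimately show ?thesis by simp
qed

section \<open>Fixed configurations as a sum over pairs of partitions\<close>

lemma prod_if_zero:
  assumes "finite A"
  shows "(\<Prod>a\<in>A. if Q a then g a else (0 :: nat)) = (\<Prod>a\<in>A. g a) * of_bool (\<forall>a\<in>A. Q a)"
  using assms by (induction rule: finite_induct) auto

lemma partition_sum_filter:
  assumes "finite A"
  shows "partition_sum (\<lambda>b. if Q b then g b else 0) A =
    (\<Sum>\<beta> | partition_on A \<beta>. (\<Prod>b\<in>\<beta>. g b) * of_bool (\<forall>b\<in>\<beta>. Q b))"
  unfolding partition_sum_def
  using finite_elements[OF assms] by (intro sum.cong prod_if_zero) auto

lemma union_of_blocks_iff:
  assumes part: "partition_on A \<beta>" and E: "E \<subseteq> A"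
  shows "union_of_blocks \<beta> E \<longleftrightarrow> (\<forall>b\<in>\<beta>. b \<subseteq> E \<or> b \<inter> E = {})"
proof
  assume "union_of_blocks \<beta> E"
  then obtain Q where Q: "Q \<subseteq> \<beta>" "E = \<Union>Q" by (auto simp: union_of_blocks_def)
  show "\<forall>b\<in>\<beta>. b \<subseteq> E \<or> b \<inter> E = {}"
  proof
    fix b assume b: "b \<in> \<beta>"
    show "b \<subseteq> E \<or> b \<inter> E = {}"
    proof (cases "b \<in> Q")
      case False
      then have "b \<inter> c = {}" if "c \<in> Q" for c
        using disjointD[OF partition_onD2[OF part] b, of c] that Q by auto
      then show ?thesis using Q by auto
    qed (use Q in auto)
  qed
next
  assume *: "\<forall>b\<in>\<beta>. b \<subseteq> E \<or> b \<inter> E = {}"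
  have "E = \<Union>{b \<in> \<beta>. b \<subseteq> E}"
  proof (intro equalityI subsetI)
    fix x assume x: "x \<in> E"
    then have "x \<in> \<Union>\<beta>" using E partition_onD1[OF part] by auto
    then obtain b where "b \<in> \<beta>" "x \<in> b" by auto
    then show "x \<in> \<Union>{b \<in> \<beta>. b \<subseteq> E}" using * x by auto
  qed auto
  then show "union_of_blocks \<beta> E" unfolding union_of_blocks_def
    by (intro exI[of _ "{b \<in> \<beta>. b \<subseteq> E}"]) auto
qed

text \<open>Refining \<pi> is a condition on single blocks, so it can be built into the block weight
  as a zero on sets not contained in a block of \<pi>. The sum then runs over all partitions of
  \<open>A\<close> and factors over the blocks of \<pi>.\<close>

lemma sum_finer_partitions:
  assumes \<pi>: "partition_on A \<pi>" and fin: "finite A" and Es: "\<And>E. E \<in> set Es \<Longrightarrow> E \<subseteq> A"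
  shows "(\<Sum>\<beta> | refines A \<beta> \<pi>.
      (\<Prod>b\<in>\<beta>. fact (card b - 1)) * of_bool (\<forall>E\<in>set Es. union_of_blocks \<beta> E)) =
    (\<Prod>B\<in>\<pi>. partition_sum (\<lambda>b. if unsplit Es b then fact (card b - 1) else 0) B)"
proof -
  let ?f = "\<lambda>b. if (\<exists>B\<in>\<pi>. b \<subseteq> B) \<and> unsplit Es b then fact (card b - 1) else (0 :: nat)"
  have "(\<Sum>\<beta> | refines A \<beta> \<pi>.
      (\<Prod>b\<in>\<beta>. fact (card b - 1)) * of_bool (\<forall>E\<in>set Es. union_of_blocks \<beta> E)) =
    (\<Sum>\<beta> | partition_on A \<beta>.
      (\<Prod>b\<in>\<beta>. fact (card b - 1) :: nat) * of_bool (\<forall>b\<in>\<beta>. (\<exists>B\<in>\<pi>. b \<subseteq> B) \<and> unsplit Es b))"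
  proof (rule sum.mono_neutral_cong_left)
    show "finite {\<beta>. partition_on A \<beta>}" using fin by (rule finitely_many_partition_on)
    show "{\<beta>. refines A \<beta> \<pi>} \<subseteq> {\<beta>. partition_on A \<beta>}" by (auto simp: refines_def)
    show "\<forall>\<beta>\<in>{\<beta>. partition_on A \<beta>} - {\<beta>. refines A \<beta> \<pi>}.
      (\<Prod>b\<in>\<beta>. fact (card b - 1)) * of_bool (\<forall>b\<in>\<beta>. (\<exists>B\<in>\<pi>. b \<subseteq> B) \<and> unsplit Es b) = (0 :: nat)"
      using \<pi> by (auto simp: refines_def)
    fix \<beta> assume "\<beta> \<in> {\<beta>. refines A \<beta> \<pi>}"
    then have \<beta>: "partition_on A \<beta>" "\<forall>b\<in>\<beta>. \<exists>B\<in>\<pi>. b \<subseteq> B" by (auto simp: refines_def)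
    have "(\<forall>E\<in>set Es. union_of_blocks \<beta> E) \<longleftrightarrow> (\<forall>E\<in>set Es. \<forall>b\<in>\<beta>. b \<subseteq> E \<or> b \<inter> E = {})"
      using union_of_blocks_iff[OF \<beta>(1)] Es by simp
    also have "\<dots> \<longleftrightarrow> (\<forall>b\<in>\<beta>. (\<exists>B\<in>\<pi>. b \<subseteq> B) \<and> unsplit Es b)"
      using \<beta>(2) unfolding unsplit_def by blast
    finally show "(\<Prod>b\<in>\<beta>. fact (card b - 1)) * of_bool (\<forall>E\<in>set Es. union_of_blocks \<beta> E) =
      (\<Prod>b\<in>\<beta>. fact (card b - 1)) *
        (of_bool (\<forall>b\<in>\<beta>. (\<exists>B\<in>\<pi>. b \<subseteq> B) \<and> unsplit Es b) :: nat)" by simp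
  qed
  also have "\<dots> = partition_sum ?f A"
    by (rule partition_sum_filter[OF fin, symmetric])
  also have "\<dots> = partition_sum ?f (\<Union>\<pi>)" using partition_onD1[OF \<pi>] by simp
  also have "\<dots> = (\<Prod>B\<in>\<pi>. partition_sum ?f B)"
  proof (rule partition_sum_Union)
    show "finite \<pi>" using finite_elements[OF fin \<pi>] .
    show "finite B" if "B \<in> \<pi>" for B
      using that partition_onD1[OF \<pi>] fin by (auto intro: finite_subset)
    show disj: "disjoint \<pi>" using partition_onD2[OF \<pi>] .
    fix b B C assume *: "B \<in> \<pi>" "C \<in> \<pi>" "B \<noteq> C" "b \<inter> B \<noteq> {}" "b \<inter> C \<noteq> {}"
    have "\<not> (\<exists>D\<in>\<pi>. b \<subseteq> D)"
    proof
      assume "\<exists>D\<in>\<pi>. b \<subseteq> D"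
      then obtain D where D: "D \<in> \<pi>" "b \<subseteq> D" by blast
      then have "D = B" "D = C" using * disjointD[OF disj D(1)] by blast+
      then show False using *(3) by simp
    qed
    then show "?f b = 0" by simp
  qed
  also have "\<dots> = (\<Prod>B\<in>\<pi>. partition_sum (\<lambda>b. if unsplit Es b then fact (card b - 1) else 0) B)"
    by (intro prod.cong partition_sum_cong) auto
  finally show ?thesis .
qed

lemma K_set_cases:
  assumes "partition_on A \<pi>" "B \<in> \<pi>"
  shows "B \<subseteq> K_set \<pi> E \<or> B \<inter> K_set \<pi> E = {}"
  using disjointD[OF partition_onD2[OF assms(1)] assms(2)] assms(2) unfolding K_set_def by blast

lemma coarser_block_eq_Union:
  assumes ref: "refines A \<pi> \<alpha>" and a: "a \<in> \<alpha>"
  shows "\<Union>{B \<in> \<pi>. B \<subseteq> a} = a"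
proof (intro equalityI subsetI)
  fix x assume x: "x \<in> a"
  have part: "partition_on A \<pi>" "partition_on A \<alpha>" using ref by (auto simp: refines_def)
  have "x \<in> A" using x a partition_onD1[OF part(2)] by auto
  then obtain B where B: "B \<in> \<pi>" "x \<in> B" using partition_onD1[OF part(1)] by auto
  then obtain a' where a': "a' \<in> \<alpha>" "B \<subseteq> a'" using ref by (auto simp: refines_def)
  have "a' = a" using disjointD[OF partition_onD2[OF part(2)] a'(1) a] a' B x by auto
  then show "x \<in> \<Union>{B \<in> \<pi>. B \<subseteq> a}" using a' B by auto
qed auto

lemma blocks_within_Union:
  assumes part: "partition_on A \<pi>" and X: "X \<subseteq> \<pi>"
  shows "{B \<in> \<pi>. B \<subseteq> \<Union>X} = X"
proof (intro equalityI subsetI)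
  fix B assume B: "B \<in> {B \<in> \<pi>. B \<subseteq> \<Union>X}"
  then have "B \<noteq> {}" using partition_onD3[OF part] by auto
  then obtain x where "x \<in> B" by auto
  then obtain C where C: "C \<in> X" "x \<in> C" using B by auto
  then have "B = C" using disjointD[OF partition_onD2[OF part], of B C] B X \<open>x \<in> B\<close> by auto
  then show "B \<in> X" using C by simp
qed (use X in auto)

lemma partition_on_Union_image:
  assumes \<pi>: "partition_on A \<pi>" and \<A>: "partition_on \<pi> \<A>"
  shows "refines A \<pi> (Union ` \<A>)"
proof -
  have sub: "X \<subseteq> \<pi>" "X \<noteq> {}" if "X \<in> \<A>" for X using that \<A> by (auto simp: partition_on_def)
  have "partition_on A (Union ` \<A>)"
  proof (rule partition_onI)
    show "\<Union>(Union ` \<A>) = A"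
      using partition_onD1[OF \<pi>] partition_onD1[OF \<A>] by auto
    show "{} \<notin> Union ` \<A>"
    proof
      assume "{} \<in> Union ` \<A>"
      then obtain X where X: "X \<in> \<A>" "\<Union>X = {}" by auto
      then obtain B where "B \<in> X" using sub(2) by auto
      then have "B \<in> \<pi>" "B = {}" using X sub(1) by auto
      then show False using partition_onD3[OF \<pi>] by simp
    qed
    show "disjnt p q" if pq: "p \<in> Union ` \<A>" "q \<in> Union ` \<A>" "p \<noteq> q" for p q
    proof -
      obtain X Y where XY: "X \<in> \<A>" "Y \<in> \<A>" "p = \<Union>X" "q = \<Union>Y" using pq by auto
      then have "X \<inter> Y = {}" using disjointD[OF partition_onD2[OF \<A>], of X Y] pq by auto
      then have "B \<inter> C = {}" if "B \<in> X" "C \<in> Y" for B C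
        using disjointD[OF partition_onD2[OF \<pi>], of B C] that sub XY by blast
      then show ?thesis unfolding XY disjnt_def by blast
    qed
  qed
  moreover have "\<exists>a\<in>Union ` \<A>. B \<subseteq> a" if "B \<in> \<pi>" for B
  proof -
    have "B \<in> \<Union>\<A>" using that partition_onD1[OF \<A>] by simp
    then show ?thesis by auto
  qed
  ultimately show ?thesis using \<pi> by (auto simp: refines_def)
qed

lemma partition_on_blocks_within:
  assumes ref: "refines A \<pi> \<alpha>"
  shows "partition_on \<pi> ((\<lambda>a. {B \<in> \<pi>. B \<subseteq> a}) ` \<alpha>)"
proof (rule partition_onI)
  have part: "partition_on A \<pi>" "partition_on A \<alpha>" using ref by (auto simp: refines_def)
  show "\<Union>((\<lambda>a. {B \<in> \<pi>. B \<subseteq> a}) ` \<alpha>) = \<pi>" using ref by (auto simp: refines_def)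
  show "{} \<notin> (\<lambda>a. {B \<in> \<pi>. B \<subseteq> a}) ` \<alpha>"
  proof
    assume "{} \<in> (\<lambda>a. {B \<in> \<pi>. B \<subseteq> a}) ` \<alpha>"
    then obtain a where a: "a \<in> \<alpha>" "{B \<in> \<pi>. B \<subseteq> a} = {}" by (metis (no_types, lifting) imageE)
    then have "a = {}" using coarser_block_eq_Union[OF ref a(1)] unfolding a(2) by simp
    then show False using partition_onD3[OF part(2)] a(1) by simp
  qed
  show "disjnt p q"
    if pq: "p \<in> (\<lambda>a. {B \<in> \<pi>. B \<subseteq> a}) ` \<alpha>" "q \<in> (\<lambda>a. {B \<in> \<pi>. B \<subseteq> a}) ` \<alpha>" "p \<noteq> q" for p q
  proof -
    obtain a b where ab: "a \<in> \<alpha>" "b \<in> \<alpha>" "p = {B \<in> \<pi>. B \<subseteq> a}" "q = {B \<in> \<pi>. B \<subseteq> b}"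
      using pq(1,2) unfolding image_iff by blast
    then have d: "a \<inter> b = {}" using disjointD[OF partition_onD2[OF part(2)], of a b] pq(3) by auto
    show ?thesis
      unfolding disjnt_def
    proof (rule equals0I)
      fix B assume "B \<in> p \<inter> q"
      then have "B \<in> \<pi>" "B \<subseteq> a \<inter> b" using ab by auto
      then show False using d partition_onD3[OF part(1)] by simp
    qed
  qed
qed

text \<open>Coarsenings of \<pi> correspond to partitions of the set \<pi>: a block of \<alpha>
  becomes the set of blocks of \<pi> inside it, and taking unions is the inverse. The condition on
  \<open>K_set \<pi> E\<close> becomes the condition that \<open>front_blocks \<pi> E\<close> splits
  none of these sets.\<close>

lemma sum_coarser_partitions:
  assumes \<pi>: "partition_on A \<pi>" and fin: "finite A"
  shows "(\<Sum>\<alpha> | refines A \<pi> \<alpha>. (\<Prod>a\<in>\<alpha>. fact (card {B \<in> \<pi>. B \<subseteq> a} - 1)) *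
      of_bool (\<forall>E\<in>set Es. union_of_blocks \<alpha> (K_set \<pi> E))) =
    partition_sum (\<lambda>X. if unsplit (map (front_blocks \<pi>) Es) X then fact (card X - 1) else 0) \<pi>"
proof -
  let ?blk = "\<lambda>a. {B \<in> \<pi>. B \<subseteq> a}"
  have fin\<pi>: "finite \<pi>" using finite_elements[OF fin \<pi>] .
  show ?thesis
    unfolding partition_sum_filter[OF fin\<pi>]
  proof (rule sum.reindex_bij_witness[where i = "\<lambda>\<A>. Union ` \<A>" and j = "\<lambda>\<alpha>. ?blk ` \<alpha>"])
    fix \<A> assume "\<A> \<in> {\<A>. partition_on \<pi> \<A>}"
    then have \<A>: "partition_on \<pi> \<A>" by simp
    then show "Union ` \<A> \<in> {\<alpha>. refines A \<pi> \<alpha>}" using partition_on_Union_image[OF \<pi>] by simp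
    have "?blk (\<Union>X) = X" if "X \<in> \<A>" for X
      using blocks_within_Union[OF \<pi>, of X] that partition_onD1[OF \<A>] by auto
    then show "?blk ` Union ` \<A> = \<A>" by (simp add: image_image)
  next
    fix \<alpha> assume "\<alpha> \<in> {\<alpha>. refines A \<pi> \<alpha>}"
    then have ref: "refines A \<pi> \<alpha>" by simp
    then have part: "partition_on A \<alpha>" by (simp add: refines_def)
    note blk = coarser_block_eq_Union[OF ref]
    show "Union ` ?blk ` \<alpha> = \<alpha>" using blk by (simp add: image_image)
    show "?blk ` \<alpha> \<in> {\<A>. partition_on \<pi> \<A>}" using partition_on_blocks_within[OF ref] by simp
    have "inj_on ?blk \<alpha>" by (rule inj_onI) (metis blk)
    then have "(\<Prod>X\<in>?blk ` \<alpha>. fact (card X - 1)) = (\<Prod>a\<in>\<alpha>. fact (card (?blk a) - 1) :: nat)"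
      by (simp add: prod.reindex)
    moreover have "(\<forall>X\<in>?blk ` \<alpha>. unsplit (map (front_blocks \<pi>) Es) X) \<longleftrightarrow>
        (\<forall>E\<in>set Es. union_of_blocks \<alpha> (K_set \<pi> E))"
    proof -
      have "union_of_blocks \<alpha> (K_set \<pi> E) \<longleftrightarrow>
          (\<forall>a\<in>\<alpha>. ?blk a \<subseteq> front_blocks \<pi> E \<or> ?blk a \<inter> front_blocks \<pi> E = {})" for E
      proof -
        let ?K = "K_set \<pi> E"
        have "?K \<subseteq> A" using partition_onD1[OF \<pi>] by (auto simp: K_set_def)
        then have "union_of_blocks \<alpha> ?K \<longleftrightarrow> (\<forall>a\<in>\<alpha>. a \<subseteq> ?K \<or> a \<inter> ?K = {})"
          by (rule union_of_blocks_iff[OF part])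
        moreover have "a \<subseteq> ?K \<longleftrightarrow> ?blk a \<subseteq> front_blocks \<pi> E" if a: "a \<in> \<alpha>" for a
        proof -
          have "a \<subseteq> ?K \<longleftrightarrow> \<Union>(?blk a) \<subseteq> ?K" using blk[OF a] by simp
          then show ?thesis by (auto simp: front_blocks_def)
        qed
        moreover have "a \<inter> ?K = {} \<longleftrightarrow> ?blk a \<inter> front_blocks \<pi> E = {}" if a: "a \<in> \<alpha>" for a
        proof -
          have "a \<inter> ?K = {} \<longleftrightarrow> \<Union>(?blk a) \<inter> ?K = {}" using blk[OF a] by simp
          also have "\<dots> \<longleftrightarrow> (\<forall>B\<in>?blk a. B \<inter> ?K = {})" by auto
          \<comment> \<open>A block of \<pi> is nonempty and either inside \<open>?K\<close> or
            disjoint from it, so the two alternatives exclude each other.\<close>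
          also have "\<dots> \<longleftrightarrow> (\<forall>B\<in>?blk a. \<not> B \<subseteq> ?K)"
          proof (rule ball_cong[OF refl])
            fix B assume "B \<in> ?blk a"
            then have "B \<in> \<pi>" "B \<noteq> {}" using partition_onD3[OF \<pi>] by auto
            then show "B \<inter> ?K = {} \<longleftrightarrow> \<not> B \<subseteq> ?K" using K_set_cases[OF \<pi>, of B E] by auto
          qed
          finally show ?thesis by (auto simp: front_blocks_def)
        qed
        ultimately show ?thesis by simp
      qed
      then show ?thesis unfolding unsplit_def by simp blast
    qed
    ultimately show "(\<Prod>X\<in>?blk ` \<alpha>. fact (card X - 1)) *
        of_bool (\<forall>X\<in>?blk ` \<alpha>. unsplit (map (front_blocks \<pi>) Es) X) =
      (\<Prod>a\<in>\<alpha>. fact (card (?blk a) - 1)) *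
        (of_bool (\<forall>E\<in>set Es. union_of_blocks \<alpha> (K_set \<pi> E)) :: nat)"
      by simp
  qed
qed

text \<open>The orders of the shelves account for \<alpha> and the orders of the books for \<beta>.
  Given \<pi>, the conditions on the two are independent, so the product of the two counts is a sum
  over pairs.\<close>

theorem card_fixed_configs_eq_sum_pairs:
  assumes \<pi>: "partition_on {1..n} \<pi>" and fin: "finite (library_configs \<pi>)"
    and Es: "set Es \<subseteq> Pow {1..n}"
  shows "card {c \<in> library_configs \<pi>. foldr (library_step \<pi>) Es c = c} =
    (\<Sum>(\<alpha>, \<beta>)\<in>library_pairs n \<pi>. library_multiplicity \<pi> \<alpha> \<beta> *
      of_bool (\<forall>E\<in>set Es. union_of_blocks \<beta> E \<and> union_of_blocks \<alpha> (K_set \<pi> E)))"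
proof -
  have fin\<pi>: "finite \<pi>" using finite_elements[OF _ \<pi>] by simp
  have finB: "finite B" if "B \<in> \<pi>" for B
  proof (rule finite_subset)
    show "B \<subseteq> {1..n}" using that partition_onD1[OF \<pi>] by auto
  qed simp
  let ?g = "\<lambda>\<alpha>. (\<Prod>a\<in>\<alpha>. fact (card {B \<in> \<pi>. B \<subseteq> a} - 1)) *
    of_bool (\<forall>E\<in>set Es. union_of_blocks \<alpha> (K_set \<pi> E)) :: nat"
  let ?h = "\<lambda>\<beta>. (\<Prod>b\<in>\<beta>. fact (card b - 1)) * of_bool (\<forall>E\<in>set Es. union_of_blocks \<beta> E) :: nat"
  have "card {c \<in> library_configs \<pi>. foldr (library_step \<pi>) Es c = c} =
      partition_sum (\<lambda>X. if unsplit (map (front_blocks \<pi>) Es) X then fact (card X - 1) else 0) \<pi> *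
      (\<Prod>B\<in>\<pi>. partition_sum (\<lambda>b. if unsplit Es b then fact (card b - 1) else 0) B)"
    using finB by (simp only: card_fixed_configs[OF fin fin\<pi>] card_fixed_orders[OF fin\<pi>])
      (simp add: card_fixed_orders)
  also have "\<dots> = (\<Sum>\<alpha> | refines {1..n} \<pi> \<alpha>. ?g \<alpha>) * (\<Sum>\<beta> | refines {1..n} \<beta> \<pi>. ?h \<beta>)"
    using Es by (subst sum_coarser_partitions[OF \<pi>], simp, subst sum_finer_partitions[OF \<pi>]) auto
  also have "\<dots> = (\<Sum>(\<alpha>, \<beta>)\<in>{\<alpha>. refines {1..n} \<pi> \<alpha>} \<times> {\<beta>. refines {1..n} \<beta> \<pi>}. ?g \<alpha> * ?h \<beta>)"
    unfolding sum_product sum.cartesian_product ..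
  also have "{\<alpha>. refines {1..n} \<pi> \<alpha>} \<times> {\<beta>. refines {1..n} \<beta> \<pi>} = library_pairs n \<pi>"
    by (auto simp: library_pairs_def)
  finally show ?thesis
    by (auto simp: library_multiplicity_def intro!: sum.cong)
qed

section \<open>Words in Fib\<close>


text \<open>In contrast to \<open>op_le\<close>, the order of the blocks is disregarded. A right
  factor of \<open>op_comp\<close> only cuts the blocks of the left factor and orders the pieces of
  each, so it is absorbed as soon as it cuts nothing.\<close>

definition finer :: "'a set list \<Rightarrow> 'a set list \<Rightarrow> bool" where
  "finer Z X \<longleftrightarrow> (\<forall>A\<in>set Z. A \<noteq> {} \<and> (\<exists>B\<in>set X. A \<subseteq> B))"

lemma set_op_comp: "set (op_comp X Y) = {A \<inter> B | A B. A \<in> set X \<and> B \<in> set Y} - {{}}"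
  by (auto simp: op_comp_def drop_empty_def)

lemma finer_op_comp_left: "finer (op_comp X Y) X"
  by (auto simp: finer_def set_op_comp)

lemma finer_op_comp_right: "finer (op_comp X Y) Y"
  by (auto simp: finer_def set_op_comp)

lemma finer_trans: "finer Z Y \<Longrightarrow> finer Y X \<Longrightarrow> finer Z X"
  unfolding finer_def by (meson subset_trans)

lemma drop_empty_Int_block:
  assumes "distinct X" "disjoint (set X)" "B \<in> set X" "A \<subseteq> B" "A \<noteq> {}"
  shows "drop_empty (map ((\<inter>) A) X) = [A]"
  using assms
proof (induction X)
  case (Cons C X)
  have disj: "disjoint (set X)" using Cons.prems by (auto simp: disjoint_def)
  show ?case
  proof (cases "B = C")
    case True
    have "A \<inter> D = {}" if "D \<in> set X" for D
    proof -
      have "C \<inter> D = {}"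
        using disjointD[OF Cons.prems(2), of C D] that Cons.prems(1) by auto
      then show ?thesis using Cons.prems(4) True by auto
    qed
    then have "drop_empty (map ((\<inter>) A) X) = []" by (auto simp: drop_empty_def filter_empty_conv)
    moreover have "A \<inter> C = A" using True Cons.prems by auto
    ultimately show ?thesis using Cons.prems by simp
  next
    case False
    then have "B \<inter> C = {}" using disjointD[OF Cons.prems(2), of B C] Cons.prems by auto
    then have "A \<inter> C = {}" using Cons.prems by auto
    then show ?thesis using Cons False disj by simp
  qed
qed simp

lemma op_comp_absorb:
  assumes X: "ordered_partition_on S X" and "finer Z X"
  shows "op_comp Z X = Z"
  using assms(2)
proof (induction Z)
  case (Cons A Z)
  then obtain B where "B \<in> set X" "A \<subseteq> B" "A \<noteq> {}" by (auto simp: finer_def)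
  then have "drop_empty (map ((\<inter>) A) X) = [A]"
    using X partition_onD2 by (intro drop_empty_Int_block) (auto simp: ordered_partition_on_def)
  then show ?case using Cons by (simp add: finer_def)
qed simp

text \<open>The two second components differ only by repeated factors \<open>Y\<close>,
  \<open>R\<close> and \<open>U\<close>. Each repetition stands to the right of a product already
  finer than it, and is absorbed there.\<close>

lemma fib_comp_assoc:
  assumes "ordered_partition_on S (fst x)" "ordered_partition_on S (fst y)"
    "ordered_partition_on S (fst z)"
  shows "fib_comp (fib_comp x y) z = fib_comp x (fib_comp y z)"
proof -
  obtain Y X R T U V where xyz: "x = (Y, X)" "y = (R, T)" "z = (U, V)"
    by (cases x, cases y, cases z) simp
  let ?Z = "op_comp (op_comp Y R) U"
  have ZR: "finer ?Z (op_comp Y R)" "finer ?Z U"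
    by (rule finer_op_comp_left finer_op_comp_right)+
  have fin: "finer ?Z Y" "finer ?Z R"
    by (rule finer_trans[OF ZR(1)], rule finer_op_comp_left finer_op_comp_right)+
  have finX: "finer (op_comp ?Z X) R" "finer (op_comp ?Z X) U"
    by (rule finer_trans[OF finer_op_comp_left], rule fin ZR)+
  have "op_comp (op_comp ?Z (op_comp (op_comp (op_comp Y R) X) T)) V =
      op_comp (op_comp (op_comp (op_comp (op_comp ?Z Y) R) X) T) V"
    by (simp only: op_comp_assoc)
  also have "\<dots> = op_comp (op_comp (op_comp ?Z X) T) V"
    using op_comp_absorb[OF _ fin(1)] op_comp_absorb[OF _ fin(2)] assms xyz by simp
  also have "op_comp ?Z X = op_comp (op_comp (op_comp ?Z X) R) U"
    using op_comp_absorb[OF _ finX(1)] op_comp_absorb[OF _ finX(2)] assms xyz by simp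
  finally show ?thesis unfolding xyz fib_comp.simps by (simp only: op_comp_assoc)
qed

section \<open>Configurations as elements of Fib\<close>

context
  fixes n :: nat and \<pi> :: "nat set set"
  assumes \<pi>: "partition_on {1..n} \<pi>"
begin

lemma config_shelves:
  assumes "c \<in> library_configs \<pi>"
  shows "distinct (map set c)" "set (map set c) = \<pi>" "disjoint (set ` set c)"
    "\<And>sh. sh \<in> set c \<Longrightarrow> distinct sh"
  using assms partition_onD2[OF \<pi>] by (auto simp: library_configs_def)

text \<open>Recovers a configuration from its block order and the concatenated list of books, that
  is, from the data of its image in Fib; injectivity of \<open>fib_of_config\<close>
  follows.\<close>

lemma config_eq_filter:
  assumes "c \<in> library_configs \<pi>"
  shows "c = map (\<lambda>B. filter (\<lambda>x. x \<in> B) (concat c)) (map set c)"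
proof -
  have "map (\<lambda>sh. filter (\<lambda>x. x \<in> set sh) (concat c)) c = c"
    using filter_concat_shelf config_shelves[OF assms] by (intro map_idI) auto
  then show ?thesis by (simp add: comp_def)
qed

lemma fib_of_config_inj:
  assumes "c \<in> library_configs \<pi>" "d \<in> library_configs \<pi>" "fib_of_config c = fib_of_config d"
  shows "c = d"
proof -
  have "map set c = map set d" "concat c = concat d"
    using assms(3) by (auto simp: fib_of_config_def inj_map_eq_map inj_def)
  then show ?thesis using config_eq_filter[OF assms(1)] config_eq_filter[OF assms(2)] by simp
qed

lemma ordered_partition_on_shelves:
  assumes "c \<in> library_configs \<pi>"
  shows "ordered_partition_on {1..n} (map set c)"
  using config_shelves[OF assms] \<pi> by (simp add: ordered_partition_on_def)

lemma set_concat_config: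
  assumes c: "c \<in> library_configs \<pi>"
  shows "set (concat c) = {1..n}"
proof -
  have "set (concat c) = \<Union>\<pi>" using config_shelves(2)[OF c] by auto
  then show ?thesis using partition_onD1[OF \<pi>] by simp
qed

lemma ordered_partition_on_books:
  assumes c: "c \<in> library_configs \<pi>"
  shows "ordered_partition_on {1..n} (map (\<lambda>x. {x}) (concat c))"
proof -
  note sh = config_shelves[OF c]
  have "distinct (concat c)"
  proof (rule distinct_concat)
    show "distinct c" using sh(1) by (simp only: distinct_map)
    fix ys zs assume "ys \<in> set c" "zs \<in> set c" "ys \<noteq> zs"
    moreover from this have "set ys \<noteq> set zs" using sh(1) by (auto simp: distinct_map inj_on_def)
    ultimately show "set ys \<inter> set zs = {}" using sh(3) by (auto simp: disjoint_def)
  qed (rule sh(4))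
  then have "distinct (map (\<lambda>x. {x}) (concat c))" by (simp add: distinct_map)
  moreover have "set (map (\<lambda>x. {x}) (concat c)) = (\<lambda>x. {x}) ` {1..n}"
    unfolding set_map set_concat_config[OF c] ..
  ultimately show ?thesis
    using partition_on_singletons[of "{1..n}"] by (simp only: ordered_partition_on_def simp_thms)
qed

lemma op_comp_shelves_books:
  assumes c: "c \<in> library_configs \<pi>"
  shows "op_comp (map set c) (map (\<lambda>x. {x}) (concat c)) = map (\<lambda>x. {x}) (concat c)"
proof -
  have "op_comp (map set d) (map (\<lambda>x. {x}) (concat c)) = map (\<lambda>x. {x}) (concat d)"
    if "set d \<subseteq> set c" for d
    using that filter_concat_shelf[OF config_shelves(1,3)[OF c]]
    by (induction d) (simp_all add: drop_empty_Int_singletons del: map_map)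
  then show ?thesis by simp
qed

lemma fib_of_config_in_Fib:
  assumes c: "c \<in> library_configs \<pi>"
  shows "fib_of_config c \<in> Fib n \<pi>"
proof -
  have "union_of_blocks \<pi> b" if "b \<in> set (map set c)" for b
    using that config_shelves(2)[OF c] unfolding union_of_blocks_def
    by (intro exI[of _ "{b}"]) auto
  then show ?thesis
    using ordered_partition_on_shelves[OF c] ordered_partition_on_books[OF c]
      op_comp_shelves_books[OF c]
    by (auto simp: Fib_def fib_of_config_def op_le_def)
qed

text \<open>Two configurations have the same blocks and the same singletons up to order, so the
  right one cuts nothing in the left one, in either component.\<close>

lemma fib_comp_fib_of_config_absorb:
  assumes c: "c \<in> library_configs \<pi>" and d: "d \<in> library_configs \<pi>"
  shows "fib_comp (fib_of_config c) (fib_of_config d) = fib_of_config c"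
proof -
  have "finer (map set c) (map set d)"
    using config_shelves(2)[OF c] config_shelves(2)[OF d] partition_onD3[OF \<pi>]
    unfolding finer_def by auto
  then have 1: "op_comp (map set c) (map set d) = map set c"
    by (rule op_comp_absorb[OF ordered_partition_on_shelves[OF d]])
  have "finer (map (\<lambda>x. {x}) (concat c)) (map (\<lambda>x. {x}) (concat d))"
    unfolding finer_def set_map set_concat_config[OF c] set_concat_config[OF d] by auto
  then have 2: "op_comp (map (\<lambda>x. {x}) (concat c)) (map (\<lambda>x. {x}) (concat d)) =
      map (\<lambda>x. {x}) (concat c)"
    by (rule op_comp_absorb[OF ordered_partition_on_books[OF d]])
  show ?thesis
    unfolding fib_of_config_def fib_comp.simps 1 op_comp_shelves_books[OF c] 2 ..
qed

lemma foldr_library_step_closed: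
  "c \<in> library_configs \<pi> \<Longrightarrow> foldr (library_step \<pi>) Es c \<in> library_configs \<pi>"
  by (induction Es) (auto intro: library_step_closed)

text \<open>Associativity turns a product in the span into the concatenation of two words. The span
  is assumed to lie in Fib so that the first components are ordered partitions of one set, as
  associativity requires.\<close>

lemma span_acts_as_word:
  assumes Fib: "semigroup_span fib_comp {(q_part n \<pi> E, t_part n \<pi> E) | E. E \<subseteq> {1..n} \<and> P E} \<subseteq> Fib n \<pi>"
    and x: "x \<in> semigroup_span fib_comp {(q_part n \<pi> E, t_part n \<pi> E) | E. E \<subseteq> {1..n} \<and> P E}"
  shows "\<exists>Es. set Es \<subseteq> {E \<in> Pow {1..n}. P E} \<and> (\<forall>c\<in>library_configs \<pi>.
    fib_comp x (fib_of_config c) = fib_of_config (foldr (library_step \<pi>) Es c))"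
  using x
proof (induction rule: semigroup_span.induct)
  case (base x)
  then obtain E where E: "x = (q_part n \<pi> E, t_part n \<pi> E)" "E \<subseteq> {1..n}" "P E" by auto
  have "\<forall>c\<in>library_configs \<pi>.
      fib_comp x (fib_of_config c) = fib_of_config (foldr (library_step \<pi>) [E] c)"
    using fib_of_config_library_step[OF \<pi> E(2)] E(1) by simp
  then show ?case using E by (intro exI[of _ "[E]"]) auto
next
  case (comp x y)
  from comp.IH(1) obtain Es where Es: "set Es \<subseteq> {E \<in> Pow {1..n}. P E}"
    "\<forall>c\<in>library_configs \<pi>.
      fib_comp x (fib_of_config c) = fib_of_config (foldr (library_step \<pi>) Es c)"
    by (elim exE conjE)
  from comp.IH(2) obtain Fs where Fs: "set Fs \<subseteq> {E \<in> Pow {1..n}. P E}"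
    "\<forall>c\<in>library_configs \<pi>.
      fib_comp y (fib_of_config c) = fib_of_config (foldr (library_step \<pi>) Fs c)"
    by (elim exE conjE)
  have xy: "ordered_partition_on {1..n} (fst x)" "ordered_partition_on {1..n} (fst y)"
    using subsetD[OF Fib comp.hyps(1)] subsetD[OF Fib comp.hyps(2)] by (auto simp: Fib_def)
  have "fib_comp (fib_comp x y) (fib_of_config c) =
      fib_of_config (foldr (library_step \<pi>) (Es @ Fs) c)" if c: "c \<in> library_configs \<pi>" for c
  proof -
    have "ordered_partition_on {1..n} (fst (fib_of_config c))"
      using ordered_partition_on_shelves[OF c] by (simp add: fib_of_config_def)
    from fib_comp_assoc[OF xy this] show ?thesis
      using bspec[OF Es(2) foldr_library_step_closed[OF c, of Fs]] bspec[OF Fs(2) c] by simp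
  qed
  then show ?case using Es(1) Fs(1) by (intro exI[of _ "Es @ Fs"]) auto
qed

text \<open>The element of Fib that represents \<open>c0\<close> is itself a product of generators.
  By absorption it sends every configuration to \<open>c0\<close>, and so does the word spelling out
  this product.\<close>

lemma constant_word_exists:
  assumes Fib: "Fib n \<pi> = semigroup_span fib_comp {(q_part n \<pi> E, t_part n \<pi> E) | E. E \<subseteq> {1..n} \<and> P E}"
    and c0: "c0 \<in> library_configs \<pi>"
  obtains Es where "set Es \<subseteq> {E \<in> Pow {1..n}. P E}"
    "\<And>c. c \<in> library_configs \<pi> \<Longrightarrow> foldr (library_step \<pi>) Es c = c0"
proof -
  have "fib_of_config c0 \<in> semigroup_span fib_comp {(q_part n \<pi> E, t_part n \<pi> E) | E. E \<subseteq> {1..n} \<and> P E}"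
    using fib_of_config_in_Fib[OF c0] Fib by simp
  from span_acts_as_word[OF equalityD2[OF Fib] this]
  obtain Es where Es: "set Es \<subseteq> {E \<in> Pow {1..n}. P E}" "\<forall>c\<in>library_configs \<pi>.
      fib_comp (fib_of_config c0) (fib_of_config c) = fib_of_config (foldr (library_step \<pi>) Es c)"
    by (elim exE conjE)
  have "foldr (library_step \<pi>) Es c = c0" if c: "c \<in> library_configs \<pi>" for c
    using bspec[OF Es(2) c] fib_comp_fib_of_config_absorb[OF c0 c]
    by (intro fib_of_config_inj[OF foldr_library_step_closed[OF c] c0]) simp
  then show ?thesis by (rule that[OF Es(1)])
qed

end

section \<open>The library walk\<close>


theorem theorem4p12:
  fixes n :: nat and \<pi> :: "nat set set" and w :: "nat set \<Rightarrow> real"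
    and cs :: "nat list list list" and P :: "real mat"
  assumes "n \<ge> 1"
    and "partition_on {1..n} \<pi>"
    and "subset_distribution n w"
    and "distinct cs" and "set cs = library_configs \<pi>"
  defines "P \<equiv> library_matrix n \<pi> w cs"
  shows
    "diagonalizable_mat P \<and>
     (\<forall>(\<alpha>, \<beta>) \<in> library_pairs n \<pi>. eigenvalue P (library_eigenvalue n \<pi> w \<alpha> \<beta>)) \<and>
     (\<forall>(\<alpha>, \<beta>) \<in> library_pairs n \<pi>.
        order (library_eigenvalue n \<pi> w \<alpha> \<beta>) (char_poly P) =
          (\<Sum>(\<alpha>', \<beta>') \<in> {(\<alpha>', \<beta>') \<in> library_pairs n \<pi>.
              library_eigenvalue n \<pi> w \<alpha>' \<beta>' = library_eigenvalue n \<pi> w \<alpha> \<beta>}.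
            library_multiplicity \<pi> \<alpha>' \<beta>')) \<and>
     (\<forall>x. eigenvalue P x \<longrightarrow>
        (\<exists>(\<alpha>, \<beta>) \<in> library_pairs n \<pi>. x = library_eigenvalue n \<pi> w \<alpha> \<beta>)) \<and>
     (Fib n \<pi> = semigroup_span fib_comp
                  {(q_part n \<pi> E, t_part n \<pi> E) | E. E \<subseteq> {1..n} \<and> w E > 0} \<longrightarrow>
        (\<exists>!\<mu>. stationary_distribution P \<mu>))"
proof -
  note \<pi> = assms(2) and cs = assms(4,5)
  have w: "w E \<ge> 0" if "E \<subseteq> {1..n}" for E
    using assms(3) that by (auto simp: subset_distribution_def)
  have w1: "sum w (Pow {1..n}) = 1" using assms(3) by (simp add: subset_distribution_def)
  interpret lrb_walk cs "Pow {1..n}" "library_step \<pi>" w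
    by unfold_locales
      (use cs w in \<open>auto intro: library_step_closed library_step_idem library_step_left_regular\<close>)
  have P: "walk_mat = P"
    unfolding P_def walk_mat_def library_matrix_def library_prob_def Pow_iff ..
  have Pc: "P \<in> carrier_mat (length cs) (length cs)" using walk_mat_carrier P by simp
  have fin: "finite (library_configs \<pi>)" using cs(2) by (metis List.finite_set)
  have finp: "finite (library_pairs n \<pi>)"
  proof (rule finite_subset)
    show "library_pairs n \<pi> \<subseteq> {\<alpha>. partition_on {1..n} \<alpha>} \<times> {\<beta>. partition_on {1..n} \<beta>}"
      by (auto simp: library_pairs_def refines_def)
    show "finite ({\<alpha>. partition_on {1..n} \<alpha>} \<times> {\<beta>. partition_on {1..n} \<beta>})"
      by (intro finite_cartesian_product finitely_many_partition_on) auto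
  qed
  let ?k = "\<lambda>p. library_multiplicity \<pi> (fst p) (snd p)"
  let ?l = "\<lambda>p. library_eigenvalue n \<pi> w (fst p) (snd p)"
  let ?ok = "\<lambda>p E. union_of_blocks (snd p) E \<and> union_of_blocks (fst p) (K_set \<pi> E)"
  have fixed: "card {c \<in> set cs. foldr (library_step \<pi>) Es c = c} =
      (\<Sum>p\<in>library_pairs n \<pi>. ?k p * of_bool (\<forall>E\<in>set Es. ?ok p E))"
    if "set Es \<subseteq> Pow {1..n}" for Es
    unfolding cs(2) card_fixed_configs_eq_sum_pairs[OF \<pi> fin that] by (simp add: case_prod_unfold)
  have trace: "mat_trace (P ^\<^sub>m m) = (\<Sum>p\<in>library_pairs n \<pi>. of_nat (?k p) * ?l p ^ m)" for m
  proof -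
    have "mat_trace (P ^\<^sub>m m) = word_sum (Pow {1..n}) w m
        (\<lambda>Es. real (card {c \<in> set cs. foldr (library_step \<pi>) Es c = c}))"
      using trace_pow_walk_mat[of m] P by simp
    also have "\<dots> = word_sum (Pow {1..n}) w m
        (\<lambda>Es. \<Sum>p\<in>library_pairs n \<pi>. of_nat (?k p) * of_bool (\<forall>E\<in>set Es. ?ok p E))"
      by (rule word_sum_cong) (simp only: fixed of_nat_sum of_nat_mult of_nat_of_bool)
    \<comment> \<open>For a single pair the condition tests each letter separately, so the words of
      length \<open>m\<close> contribute the m-th power of the weight of its admissible
      sets.\<close>
    also have "\<dots> = (\<Sum>p\<in>library_pairs n \<pi>. of_nat (?k p) *
        (\<Sum>E | E \<in> Pow {1..n} \<and> ?ok p E. w E) ^ m)"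
      by (simp only: word_sum_sum word_sum_scale word_sum_of_bool_all[OF finite_I])
    finally show ?thesis by (simp add: library_eigenvalue_def)
  qed
  have diag: "diagonalizable_mat P" using walk_mat_diagonalizable P by simp
  have ord: "order x (char_poly P) = (\<Sum>p | p \<in> library_pairs n \<pi> \<and> ?l p = x. ?k p)" for x
    by (rule order_char_poly_if_traces[OF Pc diag finp trace])
  \<comment> \<open>Positivity excludes a pair of multiplicity 0, so the value of every pair is
    indeed a root.\<close>
  have k0: "?k p \<noteq> 0" for p
  proof -
    have "?k p > 0" by (simp add: library_multiplicity_def prod_pos)
    then show ?thesis by simp
  qed
  have "monic (char_poly P)" using degree_monic_char_poly[OF Pc] by simp
  then have "char_poly P \<noteq> 0" by auto
  then have ev: "eigenvalue P x \<longleftrightarrow> (\<exists>p\<in>library_pairs n \<pi>. ?l p = x)" for x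
  proof -
    have "finite {p \<in> library_pairs n \<pi>. ?l p = x}" using finp by simp
    then have "order x (char_poly P) = 0 \<longleftrightarrow> (\<forall>p\<in>{p \<in> library_pairs n \<pi>. ?l p = x}. ?k p = 0)"
      unfolding ord by (rule sum_eq_0_iff)
    then have "order x (char_poly P) = 0 \<longleftrightarrow> \<not> (\<exists>p\<in>library_pairs n \<pi>. ?l p = x)"
      using k0 by blast
    then show ?thesis
      unfolding eigenvalue_root_char_poly[OF Pc] order_root using \<open>char_poly P \<noteq> 0\<close> by (simp only: simp_thms)
  qed
  \<comment> \<open>The empty word fixes every configuration, so the number of configurations is the
    sum of all multiplicities; it is positive because \<open>(\<pi>, \<pi>)\<close> is a
    pair.\<close>
  have "cs \<noteq> []"
  proof
    assume "cs = []"
    then have "(\<Sum>p\<in>library_pairs n \<pi>. ?k p) = 0" using fixed[of "[]"] by simp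
    moreover have "(\<pi>, \<pi>) \<in> library_pairs n \<pi>"
      using refines_refl[OF \<pi>] by (simp add: library_pairs_def)
    ultimately have "?k (\<pi>, \<pi>) = 0" using finp by (simp only: sum_eq_0_iff)
    then show False using k0[of "(\<pi>, \<pi>)"] by simp
  qed
  have stat: "\<exists>!\<mu>. stationary_distribution P \<mu>"
    if Fib: "Fib n \<pi> = semigroup_span fib_comp
      {(q_part n \<pi> E, t_part n \<pi> E) | E. E \<subseteq> {1..n} \<and> w E > 0}"
  proof -
    have "hd cs \<in> library_configs \<pi>" using hd_in_set[OF \<open>cs \<noteq> []\<close>] cs(2) by simp
    then obtain Es where Es: "set Es \<subseteq> {E \<in> Pow {1..n}. w E > 0}"
      "\<And>c. c \<in> library_configs \<pi> \<Longrightarrow> foldr (library_step \<pi>) Es c = hd cs"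
      using constant_word_exists[OF \<pi> Fib] by metis
    show ?thesis
    proof (rule ex_ex1I)
      show "\<exists>\<mu>. stationary_distribution P \<mu>"
        using stationary_distribution_exists[OF w1 \<open>cs \<noteq> []\<close>] unfolding P .
      show "\<mu> = \<nu>" if "stationary_distribution P \<mu>" "stationary_distribution P \<nu>" for \<mu> \<nu>
        by (rule stationary_distribution_unique[OF w1 Es(1)])
          (use Es(2) cs(2) that P in simp_all)
    qed
  qed
  have set_eq: "{p. p \<in> library_pairs n \<pi> \<and> ?l p = x} =
      {(\<alpha>', \<beta>') \<in> library_pairs n \<pi>. library_eigenvalue n \<pi> w \<alpha>' \<beta>' = x}" for x
    by auto
  have ord': "order x (char_poly P) =
      (\<Sum>(\<alpha>', \<beta>') \<in> {(\<alpha>', \<beta>') \<in> library_pairs n \<pi>. library_eigenvalue n \<pi> w \<alpha>' \<beta>' = x}.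
        library_multiplicity \<pi> \<alpha>' \<beta>')" for x
    unfolding ord set_eq by (simp add: case_prod_unfold)
  have ev': "eigenvalue P x \<longleftrightarrow>
      (\<exists>(\<alpha>, \<beta>) \<in> library_pairs n \<pi>. x = library_eigenvalue n \<pi> w \<alpha> \<beta>)" for x
    unfolding ev case_prod_unfold by (simp only: eq_commute)
  have ev1: "\<forall>(\<alpha>, \<beta>) \<in> library_pairs n \<pi>. eigenvalue P (library_eigenvalue n \<pi> w \<alpha> \<beta>)"
    unfolding case_prod_unfold ev by blast
  show ?thesis
  proof (intro conjI impI)
    show "\<forall>(\<alpha>, \<beta>) \<in> library_pairs n \<pi>.
        order (library_eigenvalue n \<pi> w \<alpha> \<beta>) (char_poly P) =
          (\<Sum>(\<alpha>', \<beta>') \<in> {(\<alpha>', \<beta>') \<in> library_pairs n \<pi>.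
              library_eigenvalue n \<pi> w \<alpha>' \<beta>' = library_eigenvalue n \<pi> w \<alpha> \<beta>}.
            library_multiplicity \<pi> \<alpha>' \<beta>')"
      by (intro ballI case_prodI2 ord')
    show "\<forall>x. eigenvalue P x \<longrightarrow>
        (\<exists>(\<alpha>, \<beta>) \<in> library_pairs n \<pi>. x = library_eigenvalue n \<pi> w \<alpha> \<beta>)"
      by (intro allI impI) (simp only: ev')
  qed (rule diag ev1 stat, assumption?)+
qed

end
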